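(* Let $K/k$ be an absolutely $lq$-finite purely inseparable extension. Then $K/k$ is $q$-finite if and only if for every intermediate field $L\ne k$ of $K/k$, the smallest subextension $m/k$ of $L/k$ such that $L/m$ is modular is non-trivial, i.e. $m\ne L$.
   Context: All fields are commutative of characteristic $p>0$. A subset $B\subseteq K$ is an $r$-base of an extension $K/k$ if $K=k(K^p)(B)$ and, for every $x\in B$, $x\notin k(K^p)(B\setminus\{x\})$; every extension has an $r$-base and all $r$-bases of a given extension have the same cardinality. For a purely inseparable extension $K/k$ and $n\ge 1$, put $k_n=\{x\in K: x^{p^n}\in k\}$ and let $B_n$ be an $r$-base of $k_n/k$. The degree of irrationality is the cardinal $di(K/k)=\sup_{n\ge 1}|B_n|$. $K/k$ is $q$-finite if $di(K/k)$ is finite; $lq$-finite if $k_n/k$ is finite for every $n\ge1$; absolutely $lq$-finite if $K/L$ is $lq$-finite for every intermediate field $k\subseteq L\subseteq K$. An extension $L/m$ is modular if for every $n\in\mathbb N$ the fields $L^{p^n}$ and $m$ are linearly disjoint over $L^{p^n}\cap m$. For every purely inseparable extension $L/k$ there is a smallest intermediate field $m$ of $L/k$ such that $L/m$ is modular. *)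

theory Defs
  imports "HOL-Algebra.Algebra"
begin

unbundle cardinal_syntax

text \<open>Throughout, \<open>K\<close> is an ambient field and all fields are subfields of it, given as subsets
  of its carrier; an extension \<open>L/k\<close> is a pair of such subsets with \<open>k \<subseteq> L\<close>.\<close>

definition intermediate_field ::
    "('a, 'b) ring_scheme \<Rightarrow> 'a set \<Rightarrow> 'a set \<Rightarrow> 'a set \<Rightarrow> bool" where
  "intermediate_field K k L m \<longleftrightarrow> subfield m K \<and> k \<subseteq> m \<and> m \<subseteq> L"

definition purely_inseparable ::
    "('a, 'b) ring_scheme \<Rightarrow> nat \<Rightarrow> 'a set \<Rightarrow> 'a set \<Rightarrow> bool" where
  "purely_inseparable K p k L \<longleftrightarrow> (\<forall>x\<in>L. \<exists>n::nat. x [^]\<^bsub>K\<^esub> (p ^ n) \<in> k)"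

definition power_field :: "('a, 'b) ring_scheme \<Rightarrow> nat \<Rightarrow> 'a set \<Rightarrow> nat \<Rightarrow> 'a set" where
  "power_field K p L n = (\<lambda>x. x [^]\<^bsub>K\<^esub> (p ^ n)) ` L"

definition root_field ::
    "('a, 'b) ring_scheme \<Rightarrow> nat \<Rightarrow> 'a set \<Rightarrow> 'a set \<Rightarrow> nat \<Rightarrow> 'a set" where
  "root_field K p k L n = {x \<in> L. x [^]\<^bsub>K\<^esub> (p ^ n) \<in> k}"

definition r_base ::
    "('a, 'b) ring_scheme \<Rightarrow> nat \<Rightarrow> 'a set \<Rightarrow> 'a set \<Rightarrow> 'a set \<Rightarrow> bool" where
  "r_base K p k L B \<longleftrightarrow>
     B \<subseteq> L \<and>
     L = generate_field K (k \<union> power_field K p L 1 \<union> B) \<and>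
     (\<forall>x\<in>B. x \<notin> generate_field K (k \<union> power_field K p L 1 \<union> (B - {x})))"

text \<open>Competing upper bounds range only over cardinals on the type \<open>'a\<close> of the members of \<open>C\<close>.
  This loses nothing: \<open>|UNIV :: 'a set|\<close> is an upper bound of \<open>C\<close>, and every cardinal on another
  type is either above it or equinumerous to a cardinal on \<open>'a\<close>.\<close>

definition is_cardinal_sup :: "'a rel set \<Rightarrow> 'a rel \<Rightarrow> bool" where
  "is_cardinal_sup C \<kappa> \<longleftrightarrow>
     Card_order \<kappa> \<and> (\<forall>c\<in>C. c \<le>o \<kappa>) \<and>
     (\<forall>\<mu> :: 'a rel. Card_order \<mu> \<and> (\<forall>c\<in>C. c \<le>o \<mu>) \<longrightarrow> \<kappa> \<le>o \<mu>)"

lemma is_cardinal_sup_ex: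
  fixes C :: "'a rel set"
  assumes "\<And>c. c \<in> C \<Longrightarrow> Card_order c"
  shows "\<exists>\<kappa>. is_cardinal_sup C \<kappa>"
proof -
  let ?U = "{\<mu> :: 'a rel. Card_order \<mu> \<and> (\<forall>c\<in>C. c \<le>o \<mu>)}"
  have "c \<le>o |UNIV :: 'a set|" if "c \<in> C" for c
    using ordIso_ordLeq_trans[OF ordIso_symmetric[OF card_of_Field_ordIso[OF assms[OF that]]]
        card_of_mono1[OF subset_UNIV]] .
  then have "|UNIV :: 'a set| \<in> ?U"
    by simp
  then obtain \<kappa> where \<kappa>: "\<kappa> \<in> ?U" and min: "\<And>\<mu>. (\<mu>, \<kappa>) \<in> ordLess \<Longrightarrow> \<mu> \<notin> ?U"
    by (rule wfE_min[OF wf_ordLess]) auto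
  have "\<kappa> \<le>o \<mu>" if "\<mu> \<in> ?U" for \<mu>
    using \<kappa> that min[of \<mu>] not_ordLess_iff_ordLeq[of \<kappa> \<mu>]
    unfolding card_order_on_def by blast
  with \<kappa> show ?thesis
    unfolding is_cardinal_sup_def by blast
qed

text \<open>The supremum is taken over all \<open>r\<close>-bases of all \<open>k\<^sub>n/k\<close>; as the \<open>r\<close>-bases of a given
  extension are equinumerous, this is the supremum for any choice of one \<open>r\<close>-base for each \<open>n\<close>.\<close>

definition degree_of_irrationality ::
    "('a, 'b) ring_scheme \<Rightarrow> nat \<Rightarrow> 'a set \<Rightarrow> 'a set \<Rightarrow> 'a rel" where
  "degree_of_irrationality K p k L =
     (SOME \<kappa>. is_cardinal_sup {|B| | B n. n \<ge> 1 \<and> r_base K p k (root_field K p k L n) B} \<kappa>)"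

definition q_finite :: "('a, 'b) ring_scheme \<Rightarrow> nat \<Rightarrow> 'a set \<Rightarrow> 'a set \<Rightarrow> bool" where
  "q_finite K p k L \<longleftrightarrow> finite (Field (degree_of_irrationality K p k L))"

definition lq_finite :: "('a, 'b) ring_scheme \<Rightarrow> nat \<Rightarrow> 'a set \<Rightarrow> 'a set \<Rightarrow> bool" where
  "lq_finite K p k L \<longleftrightarrow> (\<forall>n\<ge>1. ring.finite_dimension K k (root_field K p k L n))"

definition absolutely_lq_finite ::
    "('a, 'b) ring_scheme \<Rightarrow> nat \<Rightarrow> 'a set \<Rightarrow> 'a set \<Rightarrow> bool" where
  "absolutely_lq_finite K p k L \<longleftrightarrow>
     (\<forall>m. intermediate_field K k L m \<longrightarrow> lq_finite K p m L)"

definition linearly_disjoint ::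
    "('a, 'b) ring_scheme \<Rightarrow> 'a set \<Rightarrow> 'a set \<Rightarrow> 'a set \<Rightarrow> bool" where
  "linearly_disjoint K C E F \<longleftrightarrow>
     (\<forall>us. set us \<subseteq> E \<and> ring.independent K C us \<longrightarrow> ring.independent K F us)"

definition modular_extension ::
    "('a, 'b) ring_scheme \<Rightarrow> nat \<Rightarrow> 'a set \<Rightarrow> 'a set \<Rightarrow> bool" where
  "modular_extension K p m L \<longleftrightarrow>
     (\<forall>n::nat. linearly_disjoint K (power_field K p L n \<inter> m) (power_field K p L n) m)"

definition smallest_modular_subfield ::
    "('a, 'b) ring_scheme \<Rightarrow> nat \<Rightarrow> 'a set \<Rightarrow> 'a set \<Rightarrow> 'a set" where
  "smallest_modular_subfield K p k L =
     (LEAST m. intermediate_field K k L m \<and> modular_extension K p m L)"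

end

theory Submission
  imports Defs
begin

text \<open>For intermediate fields \<open>m \<subseteq> L\<close> of \<open>K/k\<close> let \<open>m\<^sub>n\<close> be the field of all \<open>x \<in> L\<close> with \<open>x\<^bsup>p^n\<^esup> \<in> m\<close>, and say
that \<open>L/m\<close> has generator bound \<open>c\<close> if every finite subextension \<open>F/m\<close> is generated by \<open>c\<close>
elements. A finite purely inseparable extension \<open>F/m\<close> needs exactly \<open>log\<^sub>p [F : m(F\<^sup>p)]\<close>
generators, and counting \<open>[G : m(F\<^sup>p)]\<close> in two ways shows that this number does not grow when \<open>G/m\<close>
is replaced by a subextension \<open>F/m\<close> (\<open>generators_subextension\<close>). Hence \<open>K/k\<close> is \<open>q\<close>-finite iff
it has a generator bound (\<open>q_finite_iff_gen_bound\<close>). Generator bounds pass to smaller \<open>L\<close> and to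
larger \<open>m\<close>, and add up in towers (\<open>gen_bound_trans\<close>).

Absolute \<open>lq\<close>-finiteness enters through the descending chain condition on intermediate fields
(\<open>minimal_intermediate_exists\<close>): over the intersection \<open>I\<close> of a chain, the elements of exponent one
form a finite extension of \<open>I\<close>. The smallest \<open>m\<close> with \<open>L/m\<close> modular exists because linear
disjointness from a fixed field survives intersections (\<open>linearly_disjoint_Inter\<close>).

If \<open>K/k\<close> is not \<open>q\<close>-finite, take \<open>L\<close> minimal among the intermediate fields for which \<open>L/k\<close> has no
generator bound. A modular \<open>L/m\<close> always has a generator bound (\<open>modular_imp_gen_bound\<close>). So if the
smallest \<open>m\<close> with \<open>L/m\<close> modular were different from \<open>L\<close>, then \<open>m/k\<close>, by minimality, and \<open>L/m\<close>
would both have bounds, and so would \<open>L/k\<close>. Hence \<open>m = L\<close>.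

Conversely let \<open>L/k\<close> have a generator bound, with \<open>L \<noteq> k\<close>; a field \<open>m \<noteq> L\<close> with \<open>L/m\<close> modular is
needed (\<open>proper_modular_subfield_exists\<close>). If \<open>m(L\<^sup>p) \<noteq> L\<close> for some proper \<open>m\<close>, then \<open>m(L\<^sup>p)\<close>
will do. Otherwise choose a proper \<open>m\<close> whose least generator bound \<open>e\<close> is as small as possible. An
intermediate field \<open>S\<close> of \<open>L/m\<close> with unbounded exponent over \<open>m\<close> contains one member of a generating
system of each \<open>m\<^sub>n\<close>, so the bound of \<open>L/S\<close> is smaller than \<open>e\<close> (\<open>gen_bound_decreases\<close>), and
therefore \<open>S = L\<close>. Apply this to the union \<open>S\<close> of the fields \<open>W\<^sub>u\<close>, the intersection over \<open>d\<close> of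
the fields \<open>m(m\<^bsub>u+d\<^esub>\<^bsup>p^d\<^esup>)\<close>: some \<open>W\<^sub>u\<close> contains a finite set that lies in no extension of \<open>m\<close>
with fewer than \<open>e\<close> generators. Then every field \<open>m(m\<^bsub>u+d\<^esub>\<^bsup>p^i\<^esup>)\<close> with \<open>i \<le> d\<close> needs \<open>e\<close>
generators, so \<open>[m\<^bsub>u+d\<^esub> : m] \<ge> p\<^bsup>ed\<^esup>\<close>. As \<open>[m\<^bsub>n+1\<^esub> : m\<^sub>n] \<le> p\<^sup>e\<close> for all \<open>n\<close>, equality
holds from some \<open>n\<close> on (\<open>eventually_equiexponential\<close>), and a count of degrees shows that \<open>L/m\<^sub>n\<close> is
modular (\<open>modular_if_equiexponential\<close>).\<close>

section \<open>Roots of degree \<open>p\<close> in characteristic \<open>p\<close>\<close>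

lemma (in cring) binomial_expansion:
  assumes x: "x \<in> carrier R" and y: "y \<in> carrier R"
  shows "(x \<oplus> y) [^] (n::nat) = (\<Oplus>i\<in>{..n}. [(n choose i)] \<cdot> (x [^] i \<otimes> y [^] (n - i)))"
proof (induction n)
  case 0
  show ?case using x y by simp
next
  case (Suc n)
  let ?m = "\<lambda>n i. [(n choose i)] \<cdot> (x [^] i \<otimes> y [^] (n - i))"
  have c: "?m n i \<in> carrier R" for n i using x y by simp
  let ?A = "\<lambda>i. [(n choose i)] \<cdot> (x [^] (Suc i) \<otimes> y [^] (n - i))"
  let ?B = "\<lambda>i. [(n choose i)] \<cdot> (x [^] i \<otimes> y [^] (Suc n - i))"
  have cA: "?A i \<in> carrier R" and cB: "?B i \<in> carrier R" for i using x y by simp_all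
  have "(x \<oplus> y) [^] Suc n = (\<Oplus>i\<in>{..n}. ?m n i) \<otimes> (x \<oplus> y)"
    using Suc.IH by simp
  also have "\<dots> = (\<Oplus>i\<in>{..n}. ?m n i \<otimes> (x \<oplus> y))"
    using x y c by (intro finsum_ldistr) auto
  also have "\<dots> = (\<Oplus>i\<in>{..n}. ?A i \<oplus> ?B i)"
  proof (intro finsum_cong')
    fix i assume i: "i \<in> {..n}"
    then have e: "Suc n - i = Suc (n - i)" by auto
    let ?t = "x [^] i \<otimes> y [^] (n - i)"
    have t: "?t \<in> carrier R" using x y by simp
    have "?m n i \<otimes> (x \<oplus> y) = [(n choose i)] \<cdot> (?t \<otimes> x) \<oplus> [(n choose i)] \<cdot> (?t \<otimes> y)"
      using x y t by (simp add: r_distr add_pow_ldistr)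
    moreover have "?t \<otimes> x = x [^] Suc i \<otimes> y [^] (n - i)" and "?t \<otimes> y = x [^] i \<otimes> y [^] (Suc n - i)"
      unfolding e using x y by (simp_all add: m_ac)
    ultimately show "?m n i \<otimes> (x \<oplus> y) = ?A i \<oplus> ?B i"
      by simp
  qed (use cA cB in auto)
  also have "\<dots> = (\<Oplus>i\<in>{..n}. ?A i) \<oplus> (\<Oplus>i\<in>{..n}. ?B i)"
    using cA cB by (intro finsum_addf) auto
  also have "(\<Oplus>i\<in>{..n}. ?B i) = (\<Oplus>i\<in>{..Suc n}. ?B i)"
  proof -
    have "?B (Suc n) = \<zero>" by (simp add: binomial_eq_0)
    then show ?thesis using cB by (simp add: finsum_Suc del: binomial_eq_0_iff binomial_Suc_n)
  qed
  also have "\<dots> = (\<Oplus>i\<in>{..n}. ?B (Suc i)) \<oplus> ?B 0"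
    using x y by (intro finsum_Suc2) auto
  also have "(\<Oplus>i\<in>{..n}. ?A i) \<oplus> ((\<Oplus>i\<in>{..n}. ?B (Suc i)) \<oplus> ?B 0) =
      ((\<Oplus>i\<in>{..n}. ?A i) \<oplus> (\<Oplus>i\<in>{..n}. ?B (Suc i))) \<oplus> ?B 0"
    using x y by (intro a_assoc[symmetric] finsum_closed) auto
  also have "(\<Oplus>i\<in>{..n}. ?A i) \<oplus> (\<Oplus>i\<in>{..n}. ?B (Suc i)) = (\<Oplus>i\<in>{..n}. ?A i \<oplus> ?B (Suc i))"
    using x y by (intro finsum_addf[symmetric]) auto
  also have "\<dots> = (\<Oplus>i\<in>{..n}. ?m (Suc n) (Suc i))"
  proof (intro finsum_cong')
    fix i assume i: "i \<in> {..n}"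
    have xi: "x [^] Suc i \<in> carrier R" using x by (rule nat_pow_closed)
    show "?A i \<oplus> ?B (Suc i) = ?m (Suc n) (Suc i)"
      using xi y by (simp add: add.nat_pow_mult del: nat_pow_Suc)
  qed (use x y in auto)
  also have "?B 0 = ?m (Suc n) 0" using x y by simp
  also have "(\<Oplus>i\<in>{..n}. ?m (Suc n) (Suc i)) \<oplus> ?m (Suc n) 0 = (\<Oplus>i\<in>{..Suc n}. ?m (Suc n) i)"
    using x y by (intro finsum_Suc2[symmetric]) auto
  finally show ?case .
qed

lemma (in cring) freshmans_dream:
  fixes p :: nat
  assumes p: "Factorial_Ring.prime p" and char: "[p] \<cdot> \<one> = \<zero>"
    and x: "x \<in> carrier R" and y: "y \<in> carrier R"
  shows "(x \<oplus> y) [^] p = x [^] p \<oplus> y [^] p"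
proof -
  let ?m = "\<lambda>i. [(p choose i)] \<cdot> (x [^] i \<otimes> y [^] (p - i))"
  have c: "?m i \<in> carrier R" for i using x y by simp
  have dvd0: "[n] \<cdot> z = \<zero>" if "p dvd n" "z \<in> carrier R" for n :: nat and z
  proof -
    obtain l where n: "n = l * p" using \<open>p dvd n\<close> by (auto simp: dvd_def mult.commute)
    have "[p] \<cdot> z = ([p] \<cdot> \<one>) \<otimes> z" using that by (simp add: add_pow_ldistr)
    then have "[p] \<cdot> z = \<zero>" using char that by simp
    then show ?thesis using that(2) add.nat_pow_pow[of z l p] by (simp add: n mult.commute)
  qed
  obtain q where q: "p = Suc q" using prime_gt_0_nat[OF p] by (cases p) auto
  have z: "?m i = \<zero>" if "0 < i" "i < p" for i
    using that x y by (intro dvd0 dvd_choose_prime p) auto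
  have "(x \<oplus> y) [^] p = (\<Oplus>i\<in>{..Suc q}. ?m i)"
    using binomial_expansion[OF x y, of p] by (simp only: q)
  also have "\<dots> = ?m p \<oplus> (\<Oplus>i\<in>{..q}. ?m i)"
    using c by (simp add: finsum_Suc q)
  also have "(\<Oplus>i\<in>{..q}. ?m i) = ?m 0"
  proof -
    have "(\<Oplus>i\<in>{..q}. ?m i) = (\<Oplus>i\<in>{..q}. if 0 = i then ?m i else \<zero>)"
      using x y z by (intro finsum_cong') (auto simp: q)
    also have "\<dots> = ?m 0"
      using x y by (intro finsum_singleton) auto
    finally show ?thesis .
  qed
  finally show ?thesis using x y by simp
qed

text \<open>Applied to the prime \<open>X - x\<close> of \<open>K[X]\<close>: a minimal polynomial dividing \<open>X\<^sup>p - x\<^sup>p = (X - x)\<^sup>p\<close> is a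
power of \<open>X - x\<close>.\<close>

lemma (in domain) divisor_of_prime_power:
  assumes \<pi>: "\<pi> \<in> carrier R" "ring_prime \<pi>"
    and "u \<in> carrier R" "v \<in> carrier R" "u \<otimes> v = \<pi> [^] (n::nat)"
  shows "\<exists>s. \<exists>c\<in>Units R. u = c \<otimes> \<pi> [^] (s::nat)"
  using assms(3-5)
proof (induction n arbitrary: u v)
  case 0
  then have "u \<otimes> v = \<one>" by simp
  moreover from this have "v \<otimes> u = \<one>" using 0 m_comm by metis
  ultimately have "u \<in> Units R" using 0 unfolding Units_def by blast
  moreover have "u = u \<otimes> \<pi> [^] (0::nat)" using 0 by simp
  ultimately show ?case by blast
next
  case (Suc n)
  have nz: "\<pi> \<noteq> \<zero>" and prime: "prime R \<pi>"
    using \<pi> by (auto simp: ring_prime_def)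
  have "\<pi> divides (u \<otimes> v)"
    using \<pi>(1) Suc.prems(3) by (auto simp: factor_def m_comm intro!: bexI[of _ "\<pi> [^] n"])
  then have "\<pi> divides u \<or> \<pi> divides v"
    using prime Suc.prems(1,2) by (auto simp: prime_def)
  then show ?case
  proof
    assume "\<pi> divides u"
    then obtain w where w: "w \<in> carrier R" "u = \<pi> \<otimes> w" by (auto simp: factor_def)
    have "\<pi> \<otimes> (w \<otimes> v) = u \<otimes> v"
      using Suc.prems w \<pi>(1) by (simp add: m_assoc)
    also have "\<dots> = \<pi> \<otimes> \<pi> [^] n"
      using Suc.prems(3) \<pi>(1) nat_pow_Suc2 by simp
    finally have "\<pi> \<otimes> (w \<otimes> v) = \<pi> \<otimes> \<pi> [^] n" .
    then have "w \<otimes> v = \<pi> [^] n"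
      using m_lcancel[OF nz \<pi>(1)] w Suc.prems \<pi>(1) by simp
    from Suc.IH[OF w(1) Suc.prems(2) this]
    obtain s c where c: "c \<in> Units R" and "w = c \<otimes> \<pi> [^] (s::nat)" by blast
    then have "u = c \<otimes> \<pi> [^] Suc s"
      using w(2) \<pi>(1) Units_closed[OF c] by (simp add: m_ac)
    then show ?thesis using c by blast
  next
    assume "\<pi> divides v"
    then obtain w where w: "w \<in> carrier R" "v = \<pi> \<otimes> w" by (auto simp: factor_def)
    have "\<pi> \<otimes> (u \<otimes> w) = u \<otimes> v"
      unfolding w(2) by (rule m_lcomm[OF \<pi>(1) Suc.prems(1) w(1)])
    also have "\<dots> = \<pi> \<otimes> \<pi> [^] n"
      using Suc.prems(3) \<pi>(1) nat_pow_Suc2 by simp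
    finally have "\<pi> \<otimes> (u \<otimes> w) = \<pi> \<otimes> \<pi> [^] n" .
    then have "u \<otimes> w = \<pi> [^] n"
      using m_lcancel[OF nz \<pi>(1)] w Suc.prems \<pi>(1) by simp
    from Suc.IH[OF Suc.prems(1) w(1) this] show ?thesis .
  qed
qed

lemma (in domain) nat_pow_nonzero:
  assumes "x \<in> carrier R" "x \<noteq> \<zero>"
  shows "x [^] (n::nat) \<noteq> \<zero>"
  using assms by (induction n) (auto simp: integral_iff)

locale char_p_field = field K for K (structure) +
  fixes p :: nat
  assumes prime_p: "Factorial_Ring.prime p"
    and char_p: "add_pow K p \<one> = \<zero>"
begin

lemma p_gt_1: "1 < p" and p_pos: "0 < p"
  using prime_gt_1_nat[OF prime_p] by auto

lemma minus_pow_p: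
  assumes "x \<in> carrier K"
  shows "(\<ominus> x) [^] p = \<ominus> (x [^] p)"
proof -
  have "(\<ominus> x) [^] p \<oplus> x [^] p = (\<ominus> x \<oplus> x) [^] p"
    using assms by (intro freshmans_dream[OF prime_p char_p, symmetric]) auto
  also have "\<dots> = \<zero>" using assms p_pos by (simp add: l_neg nat_pow_zero)
  finally show ?thesis using assms by (intro minus_equality[symmetric]) auto
qed

text \<open>The minimal polynomial of \<open>x\<close> is \<open>(X - x)\<^sup>s\<close> for some \<open>s \<le> p\<close>, and its constant term is
\<open>(-x)\<^sup>s\<close>. If \<open>s < p\<close>, then \<open>s\<close> and \<open>p\<close> are coprime, and \<open>-x\<close> is a product of powers of \<open>(-x)\<^sup>s\<close>
and \<open>(-x)\<^sup>p\<close>, both in \<open>F\<close>.\<close>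

lemma degree_inseparable_root:
  assumes F: "subfield F K" and x: "x \<in> carrier K" "x \<notin> F" "x [^] p \<in> F"
  shows "(algebraic over F) x" and "degree (Irr F x) = p"
proof -
  let ?P = "poly_ring K"
  let ?\<pi> = "[\<one>, \<ominus> x]"
  have FR: "subring F K" and Fc: "F \<subseteq> carrier K" using subfieldE[OF F] by auto
  have CR: "subring (carrier K) K" by (rule carrier_is_subring)
  interpret UP: domain ?P by (rule univ_poly_is_domain[OF CR])
  have x0: "x \<noteq> \<zero>" using x(2) subringE(2)[OF FR] by auto
  define a where "a = x [^] p"
  have aF: "a \<in> F" using x(3) by (simp add: a_def)
  obtain q where q: "p = Suc q" using p_pos by (cases p) auto
  \<comment> \<open>Coefficient lists begin with the leading coefficient: \<open>h\<close> is \<open>X\<^sup>p - a\<close>.\<close>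
  define h where "h = \<one> # replicate q \<zero> @ [\<ominus> a]"
  have hF: "h \<in> carrier (F[X])"
    using subringE[OF FR] aF by (auto simp: h_def univ_poly_carrier[symmetric] polynomial_def)
  have hmon: "eval h y = y [^] p \<oplus> \<ominus> a" if y: "y \<in> carrier K" for y
  proof -
    have "eval (monom \<one> q @ [\<ominus> a]) y = eval (monom \<one> q) y \<otimes> y \<oplus> \<ominus> a"
      using y aF Fc by (intro eval_append_aux) (auto simp: monom_def)
    then show ?thesis using y by (simp add: h_def eval_monom[OF one_closed y] monom_def[symmetric] q del: eval.simps)
        (simp add: monom_def)
  qed
  have ev: "eval h x = \<zero>" using x(1) by (simp add: hmon a_def r_neg)
  show alg: "(algebraic over F) x"
    using algebraicI[OF hF _ ev] by (auto simp: h_def)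
  let ?f = "Irr F x"
  note f = IrrE[OF F x(1) alg]
  have fP: "?f \<in> carrier ?P" and hP: "h \<in> carrier ?P"
    using carrier_polynomial_shell[OF FR] f(1) hF by auto
  have "?f pdivides h" by (rule Irr_minimal[OF F x(1) alg hF ev])
  then obtain g where g: "g \<in> carrier ?P" "h = ?f \<otimes>\<^bsub>?P\<^esub> g"
    by (auto simp: pdivides_def factor_def)
  have \<pi>P: "?\<pi> \<in> carrier ?P"
    using x(1) by (auto simp: univ_poly_carrier[symmetric] polynomial_def)
  have hpow: "h = ?\<pi> [^]\<^bsub>?P\<^esub> p"
  proof -
    have C: "normalize [b] \<in> carrier ?P" if "b \<in> carrier K" for b
      using that by (auto simp: univ_poly_carrier[symmetric] polynomial_def)
    have Cp: "normalize [b] [^]\<^bsub>?P\<^esub> n = normalize [b [^] n]" if "b \<in> carrier K" for b and n :: nat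
    proof (induction n)
      case (Suc n)
      then show ?case using that by (simp add: univ_poly_mult)
    qed (simp add: univ_poly_one)
    have "add_pow ?P n \<one>\<^bsub>?P\<^esub> = normalize [add_pow K n \<one>]" for n :: nat
    proof (induction n)
      case (Suc n)
      then show ?case by (simp add: univ_poly_add univ_poly_one)
    qed (simp add: univ_poly_zero)
    then have ch: "add_pow ?P p \<one>\<^bsub>?P\<^esub> = \<zero>\<^bsub>?P\<^esub>" using char_p by (simp add: univ_poly_zero)
    have X: "X \<in> carrier ?P" using var_closed[OF CR] by simp
    have split: "?\<pi> = X \<oplus>\<^bsub>?P\<^esub> normalize [\<ominus> x]"
      using x(1) by (simp add: univ_poly_add var_def)
    have "?\<pi> [^]\<^bsub>?P\<^esub> p = X [^]\<^bsub>?P\<^esub> p \<oplus>\<^bsub>?P\<^esub> normalize [\<ominus> x] [^]\<^bsub>?P\<^esub> p"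
      unfolding split using x(1) by (intro UP.freshmans_dream prime_p ch X C) simp
    also have "normalize [\<ominus> x] [^]\<^bsub>?P\<^esub> p = normalize [\<ominus> a]"
      using x(1) minus_pow_p[OF x(1)] by (simp only: Cp a_inv_closed a_def)
    also have "X [^]\<^bsub>?P\<^esub> p = monom \<one> q @ [\<zero>]"
      unfolding unitary_monom_eq_var_pow[OF CR, symmetric] q by (simp add: monom_def replicate_append_same)
    also have "(monom \<one> q @ [\<zero>]) \<oplus>\<^bsub>?P\<^esub> normalize [\<ominus> a] = poly_add (monom \<one> q @ [\<zero>]) [\<ominus> a]"
      unfolding univ_poly_add using aF Fc
      by (intro poly_add_normalize(2)[symmetric]) (auto simp: monom_def)
    also have "\<dots> = normalize (monom \<one> q @ [\<ominus> a])"
      using poly_add_append_replicate[of "monom \<one> q" "[\<ominus> a]"] aF Fc by (auto simp: monom_def)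
    also have "\<dots> = h" by (simp add: monom_def h_def)
    finally show ?thesis ..
  qed
  have "pirreducible (carrier K) ?\<pi>"
    by (rule degree_one_imp_pirreducible[OF carrier_is_subfield \<pi>P]) simp
  then have "ring_prime\<^bsub>?P\<^esub> ?\<pi>"
    using pprime_iff_pirreducible[OF carrier_is_subfield \<pi>P] by simp
  from UP.divisor_of_prime_power[OF \<pi>P this fP g(1) g(2)[symmetric, unfolded hpow]]
  obtain s c where c: "c \<in> Units ?P" and fs: "?f = c \<otimes>\<^bsub>?P\<^esub> ?\<pi> [^]\<^bsub>?P\<^esub> (s::nat)" by blast
  obtain d where d: "c = [d]" "d \<in> carrier K" "d \<noteq> \<zero>"
    using c univ_poly_carrier_units by auto
  have \<pi>s: "?\<pi> [^]\<^bsub>?P\<^esub> s \<in> carrier ?P" for s :: nat using \<pi>P by (rule UP.nat_pow_closed)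
  have nz: "?\<pi> [^]\<^bsub>?P\<^esub> s \<noteq> []" for s :: nat by (rule polynomial_pow_not_zero[OF \<pi>P]) simp
  have lead: "lead_coeff (?\<pi> [^]\<^bsub>?P\<^esub> s) = \<one>" for s :: nat
  proof (induction s)
    case (Suc s)
    have "lead_coeff (?\<pi> [^]\<^bsub>?P\<^esub> Suc s) = lead_coeff (poly_mult (?\<pi> [^]\<^bsub>?P\<^esub> s) ?\<pi>)"
      by (simp add: univ_poly_mult)
    also have "\<dots> = lead_coeff (?\<pi> [^]\<^bsub>?P\<^esub> s) \<otimes> lead_coeff ?\<pi>"
      using \<pi>s[of s] \<pi>P nz[of s] by (intro poly_mult_lead_coeff[OF CR]) (auto simp: univ_poly_carrier)
    finally show ?case using Suc by simp
  qed (simp add: univ_poly_one)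
  have cP: "c \<in> carrier ?P" using c by (rule UP.Units_closed)
  have "lead_coeff ?f = d \<otimes> \<one>"
    using poly_mult_lead_coeff[OF CR, of c "?\<pi> [^]\<^bsub>?P\<^esub> s"] cP \<pi>s[of s] nz[of s] d(1)
    unfolding fs univ_poly_mult by (simp add: univ_poly_carrier lead del: poly_mult.simps)
  then have "d = \<one>" using f(3) d(2) by simp
  then have f\<pi>: "?f = ?\<pi> [^]\<^bsub>?P\<^esub> s"
    using fs d(1) UP.l_one[OF \<pi>s[of s]] by (simp add: univ_poly_one)
  have deg: "degree ?f = s" using polynomial_pow_degree[OF \<pi>P, of s] f\<pi> by simp
  have "s \<le> p"
    using pdivides_imp_degree_le[OF FR f(1) hF _ \<open>?f pdivides h\<close>] deg by (simp add: h_def q)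
  have s1: "s \<ge> 1" using pirreducible_degree[OF F f(1,2)] deg by simp
  show "degree ?f = p"
  proof (rule ccontr)
    assume "degree ?f \<noteq> p"
    then have "s < p" using \<open>s \<le> p\<close> deg by simp
    then have cop: "coprime s p"
      using s1 prime_p by (metis coprime_commute dvd_imp_le linorder_not_le prime_imp_coprime zero_less_one_class.zero_less_one order_less_le_trans)
    \<comment> \<open>Evaluation at zero yields the constant term of \<open>(X - x)\<^sup>s\<close>.\<close>
    interpret ev0: ring_hom_ring ?P K "\<lambda>f. eval f \<zero>"
      by (rule eval_ring_hom[OF CR]) simp
    have "eval ?f \<zero> \<in> F"
      using const_term_simprules_shell(1)[OF FR f(1)] by (simp add: const_term_def)
    moreover have "eval ?f \<zero> = (\<ominus> x) [^] s"
    proof -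
      have "eval ?f \<zero> = eval ?\<pi> \<zero> [^] s" unfolding f\<pi> by (rule ev0.hom_nat_pow[OF \<pi>P])
      then show ?thesis using x(1) by simp
    qed
    ultimately have m: "(\<ominus> x) [^] s \<in> F" by simp
    let ?y = "\<ominus> x"
    have y: "?y \<in> carrier K" "?y \<noteq> \<zero>" using x(1) x0 by (auto simp: )
    have yp: "?y [^] p \<in> F" using x(1,3) subringE(5)[OF FR] by (simp add: minus_pow_p)
    have pw: "z [^] n \<in> F" if "z \<in> F" for z and n :: nat
      using that subringE[OF FR] by (induction n) auto
    obtain i j where ij: "i * s = j * p + 1"
      using bezout_nat[of s p] s1 cop by (auto simp: mult.commute)
    have "?y [^] (i * s) \<in> F" using pw[OF m, of i] y by (simp add: nat_pow_pow mult.commute)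
    moreover have "?y [^] (j * p) \<in> F" using pw[OF yp, of j] y by (simp add: nat_pow_pow mult.commute)
    moreover have "?y [^] (i * s) = ?y [^] (j * p) \<otimes> ?y" using y ij by simp
    moreover have "?y [^] (j * p) \<noteq> \<zero>" using y by (rule nat_pow_nonzero)
    ultimately have "?y \<in> F" using subfield_m_inv_simprule[OF F, of "?y [^] (j * p)" ?y] y by auto
    then have "\<ominus> ?y \<in> F" using subringE(5)[OF FR] by simp
    then show False using x by simp
  qed
qed

end

context char_p_field
begin

lemma frobenius_hom: "(\<lambda>x. x [^] (p ^ n)) \<in> ring_hom K K"
proof -
  have "(x \<oplus> y) [^] (p ^ n) = x [^] (p ^ n) \<oplus> y [^] (p ^ n)"
    if "x \<in> carrier K" "y \<in> carrier K" for x y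
  proof (induction n)
    case (Suc n)
    have "(x \<oplus> y) [^] (p ^ Suc n) = ((x \<oplus> y) [^] (p ^ n)) [^] p"
      using that by (simp add: nat_pow_pow mult.commute)
    also have "\<dots> = (x [^] (p ^ n)) [^] p \<oplus> (y [^] (p ^ n)) [^] p"
      unfolding Suc using that by (intro freshmans_dream prime_p char_p) auto
    finally show ?case using that by (simp add: nat_pow_pow mult.commute)
  qed (use that in simp)
  then show ?thesis by (auto simp: ring_hom_def nat_pow_distrib)
qed

lemma frobenius_ring_hom: "ring_hom_ring K K (\<lambda>x. x [^] (p ^ n))"
  using frobenius_hom by (intro ring_hom_ring.intro ring_hom_ring_axioms.intro ring_axioms)

lemma frobenius_inj: "inj_on (\<lambda>x. x [^] (p ^ n)) (carrier K)"
  using ring_hom_ring.img_is_subfield(1)[OF frobenius_ring_hom carrier_is_subfield] by simp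

abbreviation pow :: "'a set \<Rightarrow> nat \<Rightarrow> 'a set" where
  "pow L n \<equiv> power_field K p L n"

lemma pow_subfield: "subfield F K \<Longrightarrow> subfield (pow F n) K"
  unfolding power_field_def
  using ring_hom_ring.img_is_subfield(2)[OF frobenius_ring_hom] by simp

lemma pow_carrier: "A \<subseteq> carrier K \<Longrightarrow> pow A n \<subseteq> carrier K"
  by (auto simp: power_field_def)

lemma pow_mono: "A \<subseteq> B \<Longrightarrow> pow A n \<subseteq> pow B n"
  by (auto simp: power_field_def)

lemma pow_0: "A \<subseteq> carrier K \<Longrightarrow> pow A 0 = A"
  by (force simp: power_field_def)

lemma pow_add: "A \<subseteq> carrier K \<Longrightarrow> pow A (m + n) = pow (pow A m) n"
  unfolding power_field_def image_image
  by (intro image_cong refl) (auto simp: nat_pow_pow power_add subset_iff)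

lemma subfield_pow_closed: "subfield F K \<Longrightarrow> x \<in> F \<Longrightarrow> x [^] (n::nat) \<in> F"
  using subringE[OF subfieldE(1), of F K] by (induction n) auto

lemma pow_subset: "subfield F K \<Longrightarrow> pow F n \<subseteq> F"
  by (auto simp: power_field_def subfield_pow_closed)

lemma pow_antimono: "subfield F K \<Longrightarrow> m \<le> n \<Longrightarrow> pow F n \<subseteq> pow F m"
  by (metis le_iff_add pow_add pow_mono pow_subset pow_subfield subfieldE(3) add.commute)

lemma dimension_pow:
  assumes C: "subfield C K" and d: "dimension d C E"
  shows "dimension d (pow C n) (pow E n)"
proof -
  have "E \<subseteq> carrier K" using space_subgroup_props(1)[OF C d] .
  then have "inj_on (\<lambda>x. x [^] (p ^ n)) E" using frobenius_inj inj_on_subset by blast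
  then show ?thesis
    unfolding power_field_def
    using ring_hom_ring.inj_hom_dimension[OF frobenius_ring_hom C _ _ d] by simp
qed

end

section \<open>Adjoining elements to a subfield\<close>

definition (in field) adjoin :: "'a set \<Rightarrow> 'a set \<Rightarrow> 'a set" where
  "adjoin F S = generate_field R (F \<union> S)"

context field
begin

lemma adjoin_subfield: "F \<subseteq> carrier R \<Longrightarrow> S \<subseteq> carrier R \<Longrightarrow> subfield (adjoin F S) R"
  unfolding adjoin_def by (intro generate_field_is_subfield) auto

lemma adjoin_incl: "F \<subseteq> adjoin F S" "S \<subseteq> adjoin F S"
  unfolding adjoin_def by (auto intro: generate_field.incl)

lemma adjoin_min: "subfield E R \<Longrightarrow> F \<subseteq> E \<Longrightarrow> S \<subseteq> E \<Longrightarrow> adjoin F S \<subseteq> E"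
  unfolding adjoin_def
  using generate_field_min_subfield1[of "F \<union> S" E] subfieldE(3)[of E R] by blast

lemma adjoin_mono:
  "F \<subseteq> F' \<Longrightarrow> S \<subseteq> S' \<Longrightarrow> F' \<subseteq> carrier R \<Longrightarrow> S' \<subseteq> carrier R \<Longrightarrow> adjoin F S \<subseteq> adjoin F' S'"
  unfolding adjoin_def by (intro mono_generate_field) auto

lemma adjoin_absorb: "subfield F R \<Longrightarrow> S \<subseteq> F \<Longrightarrow> adjoin F S = F"
  using adjoin_min[of F F S] adjoin_incl(1)[of F S] by auto

lemma adjoin_empty: "subfield F R \<Longrightarrow> adjoin F {} = F"
  by (rule adjoin_absorb) auto

lemma adjoin_adjoin:
  assumes "F \<subseteq> carrier R" "S \<subseteq> carrier R" "T \<subseteq> carrier R"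
  shows "adjoin (adjoin F S) T = adjoin F (S \<union> T)"
proof
  show "adjoin (adjoin F S) T \<subseteq> adjoin F (S \<union> T)"
  proof (rule adjoin_min)
    show "subfield (adjoin F (S \<union> T)) R" using assms by (intro adjoin_subfield) auto
    show "adjoin F S \<subseteq> adjoin F (S \<union> T)" using assms by (intro adjoin_mono) auto
    show "T \<subseteq> adjoin F (S \<union> T)" using adjoin_incl(2)[of "S \<union> T" F] by blast
  qed
  have "subfield (adjoin F S) R" using assms by (intro adjoin_subfield)
  then have "subfield (adjoin (adjoin F S) T) R" using assms subfieldE(3) by (intro adjoin_subfield)
  then show "adjoin F (S \<union> T) \<subseteq> adjoin (adjoin F S) T"
    using adjoin_incl(1)[of F S] adjoin_incl(2)[of S F] adjoin_incl(1)[of "adjoin F S" T] adjoin_incl(2)[of T "adjoin F S"] by (intro adjoin_min) auto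
qed

lemma adjoin_comm: "adjoin F S = adjoin S F"
  by (simp add: adjoin_def Un_commute)

lemma generate_field_finite_support:
  assumes "x \<in> generate_field R A"
  shows "\<exists>A'\<subseteq>A. finite A' \<and> x \<in> generate_field R A'"
proof -
  have mono: "generate_field R S \<subseteq> generate_field R T" if "S \<subseteq> T" for S T
  proof
    fix y assume "y \<in> generate_field R S"
    then show "y \<in> generate_field R T"
      using that by induction (auto intro: generate_field.intros)
  qed
  from assms show ?thesis
  proof induction
    case one
    show ?case by (intro exI[of _ "{}"]) (auto intro: generate_field.one)
  next
    case (incl h)
    then show ?case by (intro exI[of _ "{h}"]) (auto intro: generate_field.incl)
  next
    case (a_inv h)
    then show ?case by (blast intro: generate_field.a_inv)
  next
    case (m_inv h)
    then show ?case by (blast intro: generate_field.m_inv)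
  next
    case (eng_add h1 h2)
    then obtain S T where "S \<subseteq> A" "finite S" "h1 \<in> generate_field R S"
      "T \<subseteq> A" "finite T" "h2 \<in> generate_field R T" by blast
    then show ?case
      using mono[of S "S \<union> T"] mono[of T "S \<union> T"]
      by (intro exI[of _ "S \<union> T"]) (auto intro!: generate_field.eng_add)
  next
    case (eng_mult h1 h2)
    then obtain S T where "S \<subseteq> A" "finite S" "h1 \<in> generate_field R S"
      "T \<subseteq> A" "finite T" "h2 \<in> generate_field R T" by blast
    then show ?case
      using mono[of S "S \<union> T"] mono[of T "S \<union> T"]
      by (intro exI[of _ "S \<union> T"]) (auto intro!: generate_field.eng_mult)
  qed
qed

lemma subfield_Inter:
  assumes ne: "\<F> \<noteq> {}" and F: "\<And>F. F \<in> \<F> \<Longrightarrow> subfield F R"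
  shows "subfield (\<Inter>\<F>) R"
proof (rule subfieldI')
  note r = subringE[OF subfieldE(1)[OF F]]
  show "subring (\<Inter>\<F>) R"
  proof (rule subringI)
    show "\<Inter>\<F> \<subseteq> carrier R" using ne r(1) by blast
    show "\<one> \<in> \<Inter>\<F>" using r(3) by blast
    show "\<ominus> h \<in> \<Inter>\<F>" if "h \<in> \<Inter>\<F>" for h using that r(5) by blast
    show "h1 \<otimes> h2 \<in> \<Inter>\<F>" "h1 \<oplus> h2 \<in> \<Inter>\<F>" if "h1 \<in> \<Inter>\<F>" "h2 \<in> \<Inter>\<F>" for h1 h2
      using that r(6,7) by blast+
  qed
  show "inv z \<in> \<Inter>\<F>" if "z \<in> \<Inter>\<F> - {\<zero>}" for z
    using that subfield_m_inv(1)[OF F] by blast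
qed

lemma subfield_Int: "subfield A R \<Longrightarrow> subfield B R \<Longrightarrow> subfield (A \<inter> B) R"
  using subfield_Inter[of "{A, B}"] by auto

end

section \<open>Intermediate fields and their degrees\<close>

definition (in ring) deg :: "'a set \<Rightarrow> 'a set \<Rightarrow> nat" where
  "deg F E = (dim over F) E"

locale purely_insep = char_p_field +
  fixes k
  assumes k_subfield: "subfield k K"
    and pi: "purely_inseparable K p k (carrier K)"
begin

definition intermediate :: "'a set \<Rightarrow> bool" where
  "intermediate F \<longleftrightarrow> subfield F K \<and> k \<subseteq> F"

lemma intermediateD: assumes "intermediate F"
  shows "subfield F K" "k \<subseteq> F" "F \<subseteq> carrier K" "subring F K"
  using assms subfieldE[of F K] by (auto simp: intermediate_def)

lemma intermediate_ground: "intermediate k" and intermediate_carrier: "intermediate (carrier K)"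
  using k_subfield carrier_is_subfield subfieldE(3)[OF k_subfield] by (auto simp: intermediate_def)

lemma intermediate_adjoin: "intermediate F \<Longrightarrow> S \<subseteq> carrier K \<Longrightarrow> intermediate (adjoin F S)"
  using adjoin_subfield[of F S] adjoin_incl(1)[of F S] by (auto simp: intermediate_def dest: subfieldE(3))

text \<open>If \<open>z\<^sup>q \<in> k\<close>, then \<open>z\<^bsup>q-1\<^esup> (z\<^sup>q)\<inverse>\<close> is an inverse of \<open>z\<close>.\<close>

lemma subring_intermediate:
  assumes A: "subring A K" and kA: "k \<subseteq> A"
  shows "intermediate A"
  unfolding intermediate_def
proof (intro conjI kA subfieldI' A)
  fix z assume z: "z \<in> A - {\<zero>}"
  have zc: "z \<in> carrier K" using z subringE(1)[OF A] by auto
  obtain n where n: "z [^] (p ^ n) \<in> k" using pi zc by (auto simp: purely_inseparable_def)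
  obtain q where q: "p ^ n = Suc q" using p_pos by (cases "p ^ n") auto
  have zq: "z [^] m \<in> A" for m :: nat
    using z subringE[OF A] by (induction m) auto
  have "z [^] (p ^ n) \<noteq> \<zero>" using z zc by (intro nat_pow_nonzero) auto
  then have i: "inv (z [^] (p ^ n)) \<in> A" "z [^] (p ^ n) \<otimes> inv (z [^] (p ^ n)) = \<one>"
    using subfield_m_inv[OF k_subfield, of "z [^] (p ^ n)"] n kA by auto
  let ?w = "z [^] q \<otimes> inv (z [^] (p ^ n))"
  have w: "?w \<in> A" using zq i(1) subringE(6)[OF A] by auto
  have "z \<otimes> ?w = (z \<otimes> z [^] q) \<otimes> inv (z [^] (p ^ n))"
    using zc i(1) subringE(1)[OF A] by (intro m_assoc[symmetric]) auto
  also have "z \<otimes> z [^] q = z [^] (p ^ n)" using nat_pow_Suc2[OF zc, of q] q by simp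
  finally have "z \<otimes> ?w = \<one>" using i(2) by simp
  then have "inv z = ?w" using zc w subringE(1)[OF A] by (intro comm_inv_char) auto
  then show "inv z \<in> A" using w by simp
qed

lemma intermediate_Inter:
  assumes ne: "\<F> \<noteq> {}" and F: "\<And>F. F \<in> \<F> \<Longrightarrow> intermediate F"
  shows "intermediate (\<Inter>\<F>)"
  using subfield_Inter[OF ne intermediateD(1)[OF F]] intermediateD(2)[OF F] by (auto simp: intermediate_def)

text \<open>The last member outside \<open>F\<close> of the sequence \<open>y, y\<^sup>p, y\<^bsup>p^2\<^esup>, \<dots>\<close> has the required property.\<close>

lemma root_exists:
  assumes F: "intermediate F" and E: "intermediate E" and "F \<subset> E"
  shows "\<exists>x\<in>E. x \<notin> F \<and> x [^] p \<in> F"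
proof -
  obtain y where y: "y \<in> E" "y \<notin> F" using assms(3) by blast
  have yc: "y \<in> carrier K" using y E intermediateD by blast
  obtain N where "y [^] (p ^ N) \<in> F"
    using pi yc intermediateD(2)[OF F] by (auto simp: purely_inseparable_def)
  then have ex: "\<exists>n. y [^] (p ^ n) \<in> F" by blast
  define n where "n = (LEAST n. y [^] (p ^ n) \<in> F)"
  have n: "y [^] (p ^ n) \<in> F" using LeastI_ex[OF ex] by (simp add: n_def)
  have "n \<noteq> 0" using n y yc by (cases n) auto
  then obtain m where m: "n = Suc m" by (cases n) auto
  have "y [^] (p ^ m) \<notin> F"
    using not_less_Least[of m "\<lambda>n. y [^] (p ^ n) \<in> F"] m by (simp add: n_def)
  moreover have "(y [^] (p ^ m)) [^] p \<in> F" using n yc by (simp add: m nat_pow_pow mult.commute)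
  moreover have "y [^] (p ^ m) \<in> E" using y E by (auto intro: subfield_pow_closed intermediateD)
  ultimately show ?thesis by blast
qed

lemma deg_dimension: "intermediate F \<Longrightarrow> finite_dimension F E \<Longrightarrow> dimension (deg F E) F E"
  unfolding deg_def by (intro finite_dimensionE intermediateD)

lemma degI: "intermediate F \<Longrightarrow> dimension n F E \<Longrightarrow> deg F E = n"
  unfolding deg_def by (intro dimI intermediateD)

lemma finite_dimension_refl: "intermediate F \<Longrightarrow> finite_dimension F F" and deg_refl: "intermediate F \<Longrightarrow> deg F F = 1"
  using dimension_one intermediateD(1) finite_dimensionI degI by blast+

lemma deg_tower:
  assumes "intermediate F" "intermediate E" "finite_dimension F E" "finite_dimension E G"
  shows "finite_dimension F G" "deg F G = deg F E * deg E G"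
  unfolding deg_def using telescopic_base_dim[of F E G] assms intermediateD by auto

lemma finite_dimension_between:
  assumes F: "intermediate F" and E: "intermediate E" and G: "intermediate G" and "F \<subseteq> E" "E \<subseteq> G" and fd: "finite_dimension F G"
  shows "finite_dimension F E" "finite_dimension E G"
proof -
  have "subalgebra F E K"
    using assms(4) intermediateD[OF E] subringE[OF intermediateD(4)[OF E]]
    by (intro subalgebra.intro subring.axioms(1) subalgebra_axioms.intro) auto
  then show "finite_dimension F E" 
    using subalbegra_incl_imp_finite_dimension[OF intermediateD(1)[OF F] fd] assms(5) by blast
  obtain n where "dimension n F G" using fd by blast
  then obtain us where us: "set us \<subseteq> carrier K" "Span F us = G"
    using exists_base[OF intermediateD(1)[OF F]] by blast
  have usG: "set us \<subseteq> G" using Span_base_incl[OF intermediateD(1)[OF F] us(1)] us(2) by simp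
  have alg: "subalgebra E G K"
    using assms(5) intermediateD[OF G] subringE[OF intermediateD(4)[OF G]]
    by (intro subalgebra.intro subring.axioms(1) subalgebra_axioms.intro) auto
  have "Span E us \<subseteq> G" by (rule subalgebra_Span_incl[OF intermediateD(1)[OF E] alg usG])
  moreover have "Span F us \<subseteq> Span E us"
    unfolding Span_eq_combine_set[OF intermediateD(1)[OF F] us(1)] Span_eq_combine_set[OF intermediateD(1)[OF E] us(1)]
    using assms(4) by blast
  ultimately have "Span E us = G" using us by blast
  then show "finite_dimension E G" using Span_finite_dimension[OF intermediateD(1)[OF E] us(1)] by simp
qed

lemma deg_pos:
  assumes "intermediate F" "intermediate E" "F \<subseteq> E" "finite_dimension F E"
  shows "0 < deg F E"
proof (rule ccontr)
  assume "\<not> 0 < deg F E"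
  then have "dimension 0 F E" using deg_dimension[OF assms(1,4)] by simp
  then have "E = {\<zero>}" by (rule dimension_zero[OF intermediateD(1)[OF assms(1)]])
  then show False using subringE(3)[OF intermediateD(4)[OF assms(2)]] one_not_zero by auto
qed

lemma deg_eq_1:
  assumes F: "intermediate F" "intermediate E" "F \<subseteq> E" "finite_dimension F E" "deg F E = 1"
  shows "E = F"
proof -
  have "dimension 1 F E" using deg_dimension[OF F(1,4)] F(5) by simp
  have one: "set [\<one>] \<subseteq> G" if "intermediate G" for G using subringE(3)[OF intermediateD(4)[OF that]] by simp
  have li: "independent F [\<one>]" by (intro li_Cons li_Nil one_closed) simp
  have len: "length [\<one>] = 1" by simp
  show "E = F"
    using independent_length_eq_dimension[OF intermediateD(1)[OF F(1)] \<open>dimension 1 F E\<close> li one[OF F(2)]]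
      independent_length_eq_dimension[OF intermediateD(1)[OF F(1)] dimension_one[OF intermediateD(1)[OF F(1)]] li one[OF F(1)]]
      len by metis
qed

lemma adjoin_simple:
  assumes F: "intermediate F" and x: "x \<in> carrier K"
  shows "adjoin F {x} = simple_extension F x"
proof
  have sr: "subring (simple_extension F x) K" by (rule simple_extension_is_subring[OF intermediateD(4)[OF F] x])
  have inc: "F \<subseteq> simple_extension F x" by (rule simple_extension_incl[OF intermediateD(3)[OF F] x])
  then have "intermediate (simple_extension F x)" using sr intermediateD(2)[OF F] by (intro subring_intermediate) auto
  then show "adjoin F {x} \<subseteq> simple_extension F x"
    using inc simple_extension_mem[OF intermediateD(4)[OF F] x] by (intro adjoin_min intermediateD) auto
  show "simple_extension F x \<subseteq> adjoin F {x}"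
    using adjoin_incl[of F "{x}"] adjoin_incl(2)[of "{x}" F] x intermediateD(4)[OF intermediate_adjoin[OF F, of "{x}"]]
    by (intro simple_extension_subring_incl) auto
qed

lemma deg_adjoin_pth_root:
  assumes F: "intermediate F" and x: "x \<in> carrier K" "x \<notin> F" "x [^] p \<in> F"
  shows "finite_dimension F (adjoin F {x})" "deg F (adjoin F {x}) = p"
  using degree_inseparable_root[OF intermediateD(1)[OF F] x]
    dimension_simple_extension[OF intermediateD(1)[OF F] x(1)] F
  unfolding adjoin_simple[OF F x(1)]
  by (auto intro: finite_dimensionI degI)

text \<open>Each member of \<open>B\<close> that is not generated by the previous ones multiplies the degree by \<open>p\<close>, so a
generating subset picked greedily has the size that the degree prescribes.\<close>

lemma exponent_one_basis:
  assumes F: "intermediate F" and B: "finite B" "B \<subseteq> carrier K" "\<And>x. x \<in> B \<Longrightarrow> x [^] p \<in> F"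
  shows "\<exists>B'\<subseteq>B. adjoin F B' = adjoin F B \<and> finite_dimension F (adjoin F B) \<and> deg F (adjoin F B) = p ^ card B'"
  using B
proof (induction B)
  case empty
  then show ?case using F by (auto simp: adjoin_empty intermediateD finite_dimension_refl deg_refl)
next
  case (insert x B)
  then obtain B' where B': "B' \<subseteq> B" "adjoin F B' = adjoin F B" "finite_dimension F (adjoin F B)"
    "deg F (adjoin F B) = p ^ card B'" by auto
  have x: "x \<in> carrier K" and Bc: "B \<subseteq> carrier K" and B'c: "B' \<subseteq> carrier K"
    using insert.prems B'(1) by auto
  have E: "intermediate (adjoin F B)" by (rule intermediate_adjoin[OF F Bc])
  have ins: "adjoin F (insert x C) = adjoin (adjoin F C) {x}" if "C \<subseteq> carrier K" for C
    using adjoin_adjoin[of F C "{x}"] x that intermediateD(3)[OF F] by auto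
  show ?case
  proof (cases "x \<in> adjoin F B")
    case True
    then have "adjoin F (insert x B) = adjoin F B"
      unfolding ins[OF Bc] using E by (intro adjoin_absorb intermediateD) auto
    then show ?thesis using B' by auto
  next
    case False
    have "x [^] p \<in> adjoin F B" using insert.prems(2) adjoin_incl(1) by blast
    note st = deg_adjoin_pth_root[OF E x False this]
    have "x \<notin> B'" using False B'(1) adjoin_incl(2) by blast
    moreover have "finite B'" using B'(1) insert.hyps(1) finite_subset by blast
    ultimately have "p ^ card (insert x B') = deg F (adjoin F B) * p" using B'(4) by simp
    then have "adjoin F (insert x B') = adjoin F (insert x B) \<and>
        finite_dimension F (adjoin F (insert x B)) \<and>
        deg F (adjoin F (insert x B)) = p ^ card (insert x B')"
      using deg_tower[OF F E B'(3) st(1)] st(2) B'(2) ins[OF Bc] ins[OF B'c] by simp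
    then show ?thesis using B'(1) by (intro exI[of _ "insert x B'"]) auto
  qed
qed

text \<open>Climb from \<open>C\<close> to \<open>E\<close> by adjoining \<open>p\<close>-th roots one by one: each contributes the factor \<open>p\<close> to
\<open>[E : C]\<close>, and \<open>p\<close> or \<open>1\<close> to the degree of the composita.\<close>

lemma deg_compositum_le:
  assumes "intermediate C" "intermediate E" "C \<subseteq> E" "finite_dimension C E" "M \<subseteq> carrier K"
  shows "finite_dimension (adjoin C M) (adjoin E M) \<and> deg (adjoin C M) (adjoin E M) \<le> deg C E"
  using assms
proof (induction "deg C E" arbitrary: C rule: less_induct)
  case less
  note C = less.prems(1) and E = less.prems(2) and CE = less.prems(3) and fd = less.prems(4) and M = less.prems(5)
  show ?case
  proof (cases "C = E")
    case True
    then show ?thesis using intermediate_adjoin[OF E M] C by (simp add: finite_dimension_refl deg_refl)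
  next
    case False
    then obtain x where x: "x \<in> E" "x \<notin> C" "x [^] p \<in> C" using root_exists[OF C E] CE by blast
    have xc: "x \<in> carrier K" using x intermediateD(3)[OF E] by auto
    let ?C = "adjoin C {x}"
    have C': "intermediate ?C" using C xc by (intro intermediate_adjoin) auto
    have C'E: "?C \<subseteq> E" using x CE E by (intro adjoin_min intermediateD) auto
    note st = deg_adjoin_pth_root[OF C xc x(2,3)]
    have fd': "finite_dimension ?C E" by (rule finite_dimension_between(2)[OF C C' E adjoin_incl(1) C'E fd])
    have dg: "deg C E = p * deg ?C E" using deg_tower[OF C C' st(1) fd'] st(2) by simp
    have "deg ?C E < deg C E" using dg p_gt_1 deg_pos[OF C' E C'E fd'] by simp
    then have IH: "finite_dimension (adjoin ?C M) (adjoin E M)" "deg (adjoin ?C M) (adjoin E M) \<le> deg ?C E"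
      using less.hyps C' E C'E fd' M by blast+
    have MC: "intermediate (adjoin C M)" and MC': "intermediate (adjoin ?C M)" using C C' M by (auto intro: intermediate_adjoin)
    have eq: "adjoin ?C M = adjoin (adjoin C M) {x}"
      using adjoin_adjoin[of C M "{x}"] adjoin_adjoin[of C "{x}" M] intermediateD(3)[OF C] M xc by (simp add: Un_commute)
    have "finite_dimension (adjoin C M) (adjoin ?C M) \<and> deg (adjoin C M) (adjoin ?C M) \<le> p"
    proof (cases "x \<in> adjoin C M")
      case True
      then have "adjoin ?C M = adjoin C M" unfolding eq using MC by (intro adjoin_absorb intermediateD) auto
      then show ?thesis using MC p_pos by (simp add: finite_dimension_refl deg_refl)
    next
      case False
      have "x [^] p \<in> adjoin C M" using x(3) adjoin_incl(1) by blast
      from deg_adjoin_pth_root[OF MC xc False this] show ?thesis unfolding eq by simp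
    qed
    then show ?thesis using deg_tower[OF MC MC' _ IH(1)] IH(2) dg by (simp add: mult_le_mono)
  qed
qed

end

section \<open>The number of generators of a subextension\<close>

context purely_insep
begin

abbreviation root :: "'a set \<Rightarrow> 'a set \<Rightarrow> nat \<Rightarrow> 'a set" where
  "root F E n \<equiv> root_field K p F E n"

lemma root_mem: "x \<in> root F E n \<longleftrightarrow> x \<in> E \<and> x [^] (p ^ n) \<in> F"
  by (simp add: root_field_def)

lemma intermediate_root:
  assumes F: "intermediate F" and E: "intermediate E"
  shows "intermediate (root F E n)"
proof (rule subring_intermediate)
  interpret fr: ring_hom_ring K K "\<lambda>x. x [^] (p ^ n)" by (rule frobenius_ring_hom)
  note Fr = subringE[OF intermediateD(4)[OF F]] and Er = subringE[OF intermediateD(4)[OF E]]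
  show "subring (root F E n) K"
    using Fr Er intermediateD(3)[OF E] fr.hom_a_inv fr.hom_add fr.hom_mult
    by (intro subringI) (auto simp: root_mem subset_iff)
  show "k \<subseteq> root F E n"
    using intermediateD(2)[OF E] intermediateD(2)[OF F] subfield_pow_closed[OF k_subfield] unfolding root_field_def by blast
qed

lemma root_incl: "intermediate F \<Longrightarrow> F \<subseteq> E \<Longrightarrow> F \<subseteq> root F E n"
  unfolding root_field_def using subfield_pow_closed[OF intermediateD(1)] by blast

lemma root_subset: "root F E n \<subseteq> E"
  by (auto simp: root_mem)

lemma root_mono_exp:
  assumes F: "intermediate F" and E: "E \<subseteq> carrier K" and "m \<le> n"
  shows "root F E m \<subseteq> root F E n"
proof
  fix x assume x: "x \<in> root F E m"
  obtain d where n: "n = m + d" using assms(3) le_Suc_ex by blast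
  have "x [^] (p ^ n) = (x [^] (p ^ m)) [^] (p ^ d)"
    using x E by (auto simp: root_mem n nat_pow_pow power_add)
  then show "x \<in> root F E n" using x subfield_pow_closed[OF intermediateD(1)[OF F]] by (auto simp: root_mem)
qed

lemma root_0: "intermediate F \<Longrightarrow> E \<subseteq> carrier K \<Longrightarrow> F \<subseteq> E \<Longrightarrow> root F E 0 = F"
  by (auto simp: root_mem subset_iff dest: intermediateD(3))

lemma pow_root_subset: "pow (root F E n) n \<subseteq> F"
  by (auto simp: power_field_def root_mem)

lemma pow_subset_iff_root: "A \<subseteq> carrier K \<Longrightarrow> pow A n \<subseteq> H \<longleftrightarrow> A \<subseteq> root H (carrier K) n"
  unfolding power_field_def root_field_def by blast

lemma pow_adjoin_subset:
  assumes H: "intermediate H" and "F \<subseteq> carrier K" "S \<subseteq> carrier K" "pow F n \<subseteq> H" "pow S n \<subseteq> H"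
  shows "pow (adjoin F S) n \<subseteq> H"
proof -
  have "adjoin F S \<subseteq> root H (carrier K) n"
    using assms pow_subset_iff_root by (intro adjoin_min intermediateD intermediate_root intermediate_carrier) auto
  then show ?thesis using pow_subset_iff_root[of "adjoin F S" n H] root_subset by blast
qed

lemma finite_exponent:
  assumes m: "intermediate m" and Y: "finite Y" "Y \<subseteq> carrier K"
  shows "\<exists>n. Y \<subseteq> root m (carrier K) n"
  using Y
proof (induction Y)
  case (insert x Y)
  then obtain n where n: "Y \<subseteq> root m (carrier K) n" by auto
  obtain j where "x [^] (p ^ j) \<in> k" using pi insert.prems by (auto simp: purely_inseparable_def)
  then have "x \<in> root m (carrier K) j" using insert.prems intermediateD(2)[OF m] by (auto simp: root_mem)
  then have "insert x Y \<subseteq> root m (carrier K) (max n j)"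
    using n root_mono_exp[OF m subset_refl, of n "max n j"] root_mono_exp[OF m subset_refl, of j "max n j"] by auto
  then show ?case by blast
qed auto

text \<open>Between \<open>m\<close> and \<open>m(x)\<close> lies \<open>m(x\<^sup>p)\<close>, where \<open>x\<^sup>p\<close> has a smaller exponent.\<close>

lemma finite_dimension_adjoin_single:
  assumes m: "intermediate m" and x: "x \<in> carrier K" "x [^] (p ^ n) \<in> m"
  shows "finite_dimension m (adjoin m {x})"
  using x
proof (induction n arbitrary: x)
  case 0
  then have "adjoin m {x} = m" using m by (intro adjoin_absorb intermediateD) auto
  then show ?case using m by (simp add: finite_dimension_refl)
next
  case (Suc n)
  let ?y = "x [^] p"
  have y: "?y \<in> carrier K" "?y [^] (p ^ n) \<in> m" using Suc.prems by (auto simp: nat_pow_pow)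
  let ?M = "adjoin m {?y}"
  have M: "intermediate ?M" using m y by (intro intermediate_adjoin) auto
  have yM: "?y \<in> ?M" using adjoin_incl(2)[of "{?y}" m] by auto
  have fd: "finite_dimension ?M (adjoin ?M {x})"
  proof (cases "x \<in> ?M")
    case True
    then have "adjoin ?M {x} = ?M" using M by (intro adjoin_absorb intermediateD) auto
    then show ?thesis using M by (simp add: finite_dimension_refl)
  next
    case False
    then show ?thesis using deg_adjoin_pth_root(1)[OF M Suc.prems(1) _ yM] by simp
  qed
  have xm: "intermediate (adjoin m {x})" using m Suc.prems by (intro intermediate_adjoin) auto
  have "x \<in> adjoin m {x}" using adjoin_incl(2)[of "{x}" m] by auto
  then have "?y \<in> adjoin m {x}" using subfield_pow_closed[OF intermediateD(1)[OF xm]] by blast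
  then have "adjoin ?M {x} = adjoin m {x}"
    using adjoin_adjoin[of m "{?y}" "{x}"] adjoin_adjoin[of m "{x}" "{?y}"] y Suc.prems intermediateD(3)[OF m]
      adjoin_absorb[OF intermediateD(1)[OF xm], of "{?y}"] by (simp add: insert_commute)
  then show ?case using deg_tower(1)[OF m M Suc.IH[OF y] fd] by simp
qed

lemma finite_dimension_adjoin:
  assumes m: "intermediate m" and Y: "finite Y" "Y \<subseteq> carrier K"
  shows "finite_dimension m (adjoin m Y)"
  using Y
proof (induction Y)
  case empty
  show ?case using m by (simp add: adjoin_empty intermediateD finite_dimension_refl)
next
  case (insert x Y)
  have M: "intermediate (adjoin m Y)" using insert.prems m by (intro intermediate_adjoin) auto
  obtain n where "x [^] (p ^ n) \<in> k" using pi insert.prems by (auto simp: purely_inseparable_def)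
  then have "finite_dimension (adjoin m Y) (adjoin (adjoin m Y) {x})"
    using intermediateD(2)[OF M] insert.prems by (intro finite_dimension_adjoin_single[OF M, of x n]) auto
  moreover have "adjoin (adjoin m Y) {x} = adjoin m (insert x Y)"
    using adjoin_adjoin[of m Y "{x}"] intermediateD(3)[OF m] insert.prems by simp
  ultimately show ?case using deg_tower(1)[OF m M] insert by auto
qed

lemma finite_dimension_generators:
  assumes m: "intermediate m" and E: "intermediate E" and mE: "m \<subseteq> E" and fd: "finite_dimension m E"
  shows "\<exists>S\<subseteq>E. finite S \<and> adjoin m S = E"
proof -
  obtain n where "dimension n m E" using fd by blast
  then obtain us where us: "set us \<subseteq> carrier K" "Span m us = E"
    using exists_base[OF intermediateD(1)[OF m]] by blast
  have usE: "set us \<subseteq> E" using Span_base_incl[OF intermediateD(1)[OF m] us(1)] us(2) by simp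
  have A: "intermediate (adjoin m (set us))" by (rule intermediate_adjoin[OF m us(1)])
  have "subalgebra m (adjoin m (set us)) K"
    using adjoin_incl(1)[of m "set us"] intermediateD[OF A] subringE[OF intermediateD(4)[OF A]]
    by (intro subalgebra.intro subring.axioms(1) subalgebra_axioms.intro) auto
  then have "E \<subseteq> adjoin m (set us)"
    using subalgebra_Span_incl[OF intermediateD(1)[OF m] _ adjoin_incl(2)] us(2) by blast
  moreover have "adjoin m (set us) \<subseteq> E" using usE mE E by (intro adjoin_min intermediateD)
  ultimately show ?thesis using usE by (intro exI[of _ "set us"]) auto
qed

lemma finite_dimension_exponent:
  assumes m: "intermediate m" and E: "intermediate E" and mE: "m \<subseteq> E" and fd: "finite_dimension m E"
  shows "\<exists>n. pow E n \<subseteq> m"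
proof -
  obtain S where S: "S \<subseteq> E" "finite S" "adjoin m S = E" using finite_dimension_generators[OF assms] by blast
  have Sc: "S \<subseteq> carrier K" using S(1) intermediateD(3)[OF E] by blast
  obtain n where n: "S \<subseteq> root m (carrier K) n" using finite_exponent[OF m S(2) Sc] by blast
  have "pow (adjoin m S) n \<subseteq> m"
    using n Sc intermediateD(3)[OF m] pow_subset[OF intermediateD(1)[OF m]] pow_subset_iff_root[OF Sc]
    by (intro pow_adjoin_subset[OF m]) auto
  then show ?thesis using S(3) by blast
qed

lemma exponent_one_generators:
  assumes F: "intermediate F" and E: "intermediate E" and FE: "F \<subseteq> E" and fd: "finite_dimension F E" and "pow E 1 \<subseteq> F"
  shows "\<exists>B\<subseteq>E. finite B \<and> adjoin F B = E \<and> deg F E = p ^ card B"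
proof -
  obtain S where S: "S \<subseteq> E" "finite S" "adjoin F S = E" using finite_dimension_generators[OF F E FE fd] by blast
  have "x [^] p \<in> F" if "x \<in> S" for x using that S(1) assms(5) by (auto simp: power_field_def)
  then obtain B where "B \<subseteq> S" "adjoin F B = E" "deg F E = p ^ card B"
    using exponent_one_basis[OF F S(2)] S intermediateD(3)[OF E] by auto
  then show ?thesis using S finite_subset by blast
qed

lemma exponent_one_deg_le:
  assumes F: "intermediate F" and S: "finite S" "S \<subseteq> carrier K" "pow S 1 \<subseteq> F"
  shows "deg F (adjoin F S) \<le> p ^ card S"
proof -
  have "x [^] p \<in> F" if "x \<in> S" for x using that S(3) by (auto simp: power_field_def)
  then obtain B where "B \<subseteq> S" "deg F (adjoin F S) = p ^ card B"
    using exponent_one_basis[OF F S(1,2)] by auto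
  then show ?thesis using S(1) p_pos by (simp add: card_mono power_increasing)
qed

text \<open>A form of Nakayama's lemma: inserting \<open>E = m(E\<^sup>p)(B)\<close> into itself gives \<open>E = m(E\<^bsup>p^i\<^esup>)(B)\<close> for
all \<open>i\<close>, and for large \<open>i\<close> the powers are already in \<open>m\<close>.\<close>

lemma generators_mod_pth_powers:
  assumes m: "intermediate m" and E: "intermediate E" and mE: "m \<subseteq> E" and B: "B \<subseteq> E" and n: "pow E n \<subseteq> m"
    and gen: "adjoin (adjoin m (pow E 1)) B = E"
  shows "adjoin m B = E"
proof -
  let ?G = "adjoin m B"
  have Ec: "E \<subseteq> carrier K" and mc: "m \<subseteq> carrier K" using intermediateD(3) E m by auto
  have Bc: "B \<subseteq> carrier K" using B Ec by auto
  have G: "intermediate ?G" by (rule intermediate_adjoin[OF m Bc])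
  have GE: "?G \<subseteq> E" using mE B E by (intro adjoin_min intermediateD)
  have powc: "pow E i \<subseteq> carrier K" for i by (rule pow_carrier[OF Ec])
  have "E = adjoin ?G (pow E i)" for i
  proof (induction i)
    case 0
    have "adjoin ?G E = E"
      using adjoin_min[OF intermediateD(1)[OF E] GE subset_refl] adjoin_incl(2)[of E ?G] by (rule equalityI)
    then show ?case by (simp add: pow_0[OF Ec])
  next
    case (Suc i)
    let ?H = "adjoin ?G (pow E (Suc i))"
    have H: "intermediate ?H" by (rule intermediate_adjoin[OF G powc])
    have "pow (adjoin ?G (pow E i)) 1 \<subseteq> ?H"
    proof (rule pow_adjoin_subset[OF H intermediateD(3)[OF G] powc])
      show "pow ?G 1 \<subseteq> ?H" using pow_subset[OF intermediateD(1)[OF G]] adjoin_incl(1) by blast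
      show "pow (pow E i) 1 \<subseteq> ?H" using pow_add[OF Ec, of i 1] adjoin_incl(2)[of "pow E (Suc i)" ?G] by simp
    qed
    then have "pow E 1 \<subseteq> ?H" using Suc by simp
    moreover have "m \<subseteq> ?H" "B \<subseteq> ?H"
      using adjoin_incl(1)[of m B] adjoin_incl(2)[of B m] adjoin_incl(1)[of ?G] by blast+
    ultimately have "adjoin (adjoin m (pow E 1)) B \<subseteq> ?H"
      using H by (intro adjoin_min intermediateD) auto
    moreover have "?H \<subseteq> E" by (rule adjoin_min[OF intermediateD(1)[OF E] GE pow_subset[OF intermediateD(1)[OF E]]])
    ultimately show ?case using gen by auto
  qed
  from this[of n] have "E = adjoin ?G (pow E n)" .
  also have "\<dots> = ?G" using n adjoin_incl(1)[of m B] G by (intro adjoin_absorb intermediateD) auto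
  finally show ?thesis by simp
qed

text \<open>The field \<open>F\<^bsup>p^n\<^esup>\<close> need not contain \<open>k\<close>, but it contains \<open>k\<^bsup>p^n\<^esup>\<close>; with this as ground field
the degree estimates apply to it.\<close>

lemma pow_ground: "purely_insep K p (pow k n)"
proof (intro purely_insep.intro purely_insep_axioms.intro char_p_field_axioms)
  show "subfield (pow k n) K" by (rule pow_subfield[OF k_subfield])
  show "purely_inseparable K p (pow k n) (carrier K)"
    unfolding purely_inseparable_def
  proof
    fix x assume x: "x \<in> carrier K"
    then obtain j where j: "x [^] (p ^ j) \<in> k" using pi by (auto simp: purely_inseparable_def)
    have "x [^] (p ^ (j + n)) = (x [^] (p ^ j)) [^] (p ^ n)" using x by (simp add: nat_pow_pow power_add)
    then show "\<exists>n'. x [^] (p ^ n') \<in> pow k n" using j by (auto simp: power_field_def)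
  qed
qed

text \<open>Frobenius gives \<open>[G\<^bsup>p^n\<^esup> : F\<^bsup>p^n\<^esup>] = [G : F]\<close>, and passing to the composita with \<open>m\<close> cannot
increase a degree.\<close>

lemma deg_mod_powers_le:
  assumes m: "m \<subseteq> carrier K" and F: "intermediate F" and G: "intermediate G" and "F \<subseteq> G" and fd: "finite_dimension F G"
  shows "deg (adjoin m (pow F n)) (adjoin m (pow G n)) \<le> deg F G"
proof -
  interpret L: purely_insep K p "pow k n" by (rule pow_ground)
  have L: "L.intermediate (pow F n)" "L.intermediate (pow G n)"
    using F G pow_mono pow_subfield by (auto simp: L.intermediate_def intermediate_def)
  have "dimension (deg F G) (pow F n) (pow G n)"
    by (rule dimension_pow[OF intermediateD(1)[OF F] deg_dimension[OF F fd]])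
  then have d: "finite_dimension (pow F n) (pow G n)" "deg (pow F n) (pow G n) = deg F G"
    using L.degI[OF L(1)] finite_dimensionI by auto
  have "deg (adjoin (pow F n) m) (adjoin (pow G n) m) \<le> deg F G"
    using L.deg_compositum_le[OF L pow_mono[OF assms(4)] d(1) m] d(2) by simp
  then show ?thesis by (simp add: adjoin_comm)
qed

text \<open>With \<open>G = m(S)\<close>, the tower formula gives
\<open>[F : m(F\<^sup>p)] [G : F] = [m(G\<^sup>p) : m(F\<^sup>p)] [G : m(G\<^sup>p)]\<close>. The first factor on the right is at most
\<open>[G : F]\<close>, so \<open>[F : m(F\<^sup>p)] \<le> [G : m(G\<^sup>p)]\<close>, and the latter is at most \<open>p\<close> to the size of \<open>S\<close>.\<close>

proposition generators_subextension:
  assumes m: "intermediate m" and F: "intermediate F" and mF: "m \<subseteq> F" and FG: "F \<subseteq> adjoin m S"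
    and S: "finite S" "S \<subseteq> carrier K"
  shows "\<exists>T\<subseteq>F. finite T \<and> card T \<le> card S \<and> adjoin m T = F"
proof -
  let ?G = "adjoin m S"
  have G: "intermediate ?G" by (rule intermediate_adjoin[OF m S(2)])
  have fdG: "finite_dimension m ?G" by (rule finite_dimension_adjoin[OF m S])
  have fdF: "finite_dimension m F" and fdFG: "finite_dimension F ?G"
    using finite_dimension_between[OF m F G mF FG fdG] by auto
  let ?Fp = "adjoin m (pow F 1)" and ?Gp = "adjoin m (pow ?G 1)"
  have F0: "intermediate ?Fp" and G0: "intermediate ?Gp"
    using intermediate_adjoin[OF m pow_carrier[OF intermediateD(3)[OF F]]] intermediate_adjoin[OF m pow_carrier[OF intermediateD(3)[OF G]]]
    by auto
  have F0F: "?Fp \<subseteq> F" using mF F pow_subset[OF intermediateD(1)[OF F]] by (intro adjoin_min intermediateD)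
  have G0G: "?Gp \<subseteq> ?G"
    by (rule adjoin_min[OF intermediateD(1)[OF G] adjoin_incl(1) pow_subset[OF intermediateD(1)[OF G]]])
  have F0G0: "?Fp \<subseteq> ?Gp"
    by (rule adjoin_mono[OF subset_refl pow_mono[OF FG] intermediateD(3)[OF m] pow_carrier[OF intermediateD(3)[OF G]]])
  have mF0: "m \<subseteq> ?Fp" by (rule adjoin_incl(1))
  have fdF0F: "finite_dimension ?Fp F" by (rule finite_dimension_between(2)[OF m F0 F mF0 F0F fdF])
  have fdF0G: "finite_dimension ?Fp ?G" using finite_dimension_between(2)[OF m F0 G mF0 _ fdG] F0F FG by blast
  have fdF0G0: "finite_dimension ?Fp ?Gp" and fdG0G: "finite_dimension ?Gp ?G"
    using finite_dimension_between[OF F0 G0 G F0G0 G0G fdF0G] by auto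
  have "pow F 1 \<subseteq> ?Fp" by (rule adjoin_incl(2))
  then obtain B where B: "B \<subseteq> F" "finite B" "adjoin ?Fp B = F" "deg ?Fp F = p ^ card B"
    using exponent_one_generators[OF F0 F F0F fdF0F] by blast
  have SG: "S \<subseteq> ?G" by (rule adjoin_incl(2))
  have "adjoin ?Gp S = ?G"
  proof
    show "adjoin ?Gp S \<subseteq> ?G" by (rule adjoin_min[OF intermediateD(1)[OF G] G0G SG])
    show "?G \<subseteq> adjoin ?Gp S"
      using m adjoin_incl(1)[of m "pow ?G 1"] S(2) intermediateD(3)[OF G0] by (intro adjoin_mono) auto
  qed
  then have "deg ?Gp ?G \<le> p ^ card S"
    using exponent_one_deg_le[OF G0 S] pow_mono[OF SG, of 1] adjoin_incl(2)[of "pow ?G 1" m] by auto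
  moreover have "deg ?Fp ?Gp \<le> deg F ?G"
    by (rule deg_mod_powers_le[OF intermediateD(3)[OF m] F G FG fdFG])
  moreover have "p ^ card B * deg F ?G = deg ?Fp ?Gp * deg ?Gp ?G"
    using deg_tower(2)[OF F0 F fdF0F fdFG] deg_tower(2)[OF F0 G0 fdF0G0 fdG0G] B(4) by simp
  ultimately have "p ^ card B * deg F ?G \<le> p ^ card S * deg F ?G"
    by (metis mult.commute mult_le_mono)
  then have "card B \<le> card S"
    using deg_pos[OF F G FG fdFG] p_gt_1 by simp
  moreover obtain n where "pow F n \<subseteq> m" using finite_dimension_exponent[OF m F mF fdF] by blast
  ultimately show ?thesis
    using generators_mod_pth_powers[OF m F mF B(1) _ B(3)] B by blast
qed

section \<open>Uniformly bounded numbers of generators\<close>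

text \<open>For \<open>lq\<close>-finite \<open>L/m\<close> this says that the degree of irrationality is at most \<open>c\<close>. Ranging over all
finite subextensions, and not only over the root fields of \<open>m\<close> in \<open>L\<close>, makes it visibly inherited by
subfields of \<open>L\<close>.\<close>

definition gen_bound :: "'a set \<Rightarrow> 'a set \<Rightarrow> nat \<Rightarrow> bool" where
  "gen_bound m L c \<longleftrightarrow> (\<forall>F. intermediate F \<and> m \<subseteq> F \<and> F \<subseteq> L \<and> finite_dimension m F \<longrightarrow>
     (\<exists>S\<subseteq>F. finite S \<and> card S \<le> c \<and> adjoin m S = F))"

lemma gen_boundD:
  assumes "gen_bound m L c" "intermediate F" "m \<subseteq> F" "F \<subseteq> L" "finite_dimension m F"
  obtains S where "S \<subseteq> F" "finite S" "card S \<le> c" "adjoin m S = F"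
  using assms unfolding gen_bound_def by blast

lemma gen_bound_subset: "gen_bound m L c \<Longrightarrow> L' \<subseteq> L \<Longrightarrow> gen_bound m L' c"
  unfolding gen_bound_def by blast

text \<open>A finite set generating \<open>F\<close> over \<open>m'\<close> generates a finite extension of \<open>m\<close>; generators of the latter
also generate \<open>F\<close> over \<open>m'\<close>.\<close>

lemma gen_bound_base:
  assumes m: "intermediate m" and m': "intermediate m'" and mm': "m \<subseteq> m'" and gen_bound: "gen_bound m L c"
  shows "gen_bound m' L c"
  unfolding gen_bound_def
proof (intro allI impI, elim conjE)
  fix F assume F: "intermediate F" "m' \<subseteq> F" "F \<subseteq> L" "finite_dimension m' F"
  obtain Y where Y: "Y \<subseteq> F" "finite Y" "adjoin m' Y = F" using finite_dimension_generators[OF m' F(1,2,4)] by blast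
  have Yc: "Y \<subseteq> carrier K" using Y(1) intermediateD(3)[OF F(1)] by blast
  have A: "adjoin m Y \<subseteq> F" using mm' F Y by (intro adjoin_min intermediateD) auto
  obtain S where S: "S \<subseteq> adjoin m Y" "finite S" "card S \<le> c" "adjoin m S = adjoin m Y"
    using gen_boundD[OF gen_bound intermediate_adjoin[OF m Yc] adjoin_incl(1) _ finite_dimension_adjoin[OF m Y(2) Yc]] A F(3) by blast
  have SF: "S \<subseteq> F" using S(1) A by blast
  then have Sc: "S \<subseteq> carrier K" using intermediateD(3)[OF F(1)] by blast
  have "adjoin m S \<subseteq> adjoin m' S" using mm' Sc intermediateD(3)[OF m'] by (intro adjoin_mono) auto
  then have "Y \<subseteq> adjoin m' S" using S(4) adjoin_incl(2)[of Y m] by blast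
  then have "adjoin m' Y \<subseteq> adjoin m' S" using intermediate_adjoin[OF m' Sc] by (intro adjoin_min intermediateD adjoin_incl(1)) auto
  moreover have "adjoin m' S \<subseteq> F" using SF F by (intro adjoin_min intermediateD)
  ultimately show "\<exists>S\<subseteq>F. finite S \<and> card S \<le> c \<and> adjoin m' S = F" using SF S Y(3) by blast
qed

text \<open>The generators may be taken anywhere in \<open>K\<close>, since subextensions need no more generators.\<close>

lemma gen_boundI_finite:
  assumes m: "intermediate m"
    and Y: "\<And>Y. finite Y \<Longrightarrow> Y \<subseteq> L \<Longrightarrow> \<exists>S\<subseteq>carrier K. finite S \<and> card S \<le> c \<and> Y \<subseteq> adjoin m S"
  shows "gen_bound m L c"
  unfolding gen_bound_def
proof (intro allI impI, elim conjE)
  fix F assume F: "intermediate F" "m \<subseteq> F" "F \<subseteq> L" "finite_dimension m F"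
  obtain Y where Y': "Y \<subseteq> F" "finite Y" "adjoin m Y = F" using finite_dimension_generators[OF m F(1,2,4)] by blast
  then obtain S where S: "S \<subseteq> carrier K" "finite S" "card S \<le> c" "Y \<subseteq> adjoin m S"
    using assms(2)[of Y] F(3) by blast
  have "F \<subseteq> adjoin m S"
    using Y'(3) S(4) adjoin_min[OF intermediateD(1)[OF intermediate_adjoin[OF m S(1)]] adjoin_incl(1) S(4)] by simp
  then show "\<exists>S\<subseteq>F. finite S \<and> card S \<le> c \<and> adjoin m S = F"
    using generators_subextension[OF m F(1,2) _ S(2,1)] S(3) le_trans by meson
qed

lemma gen_bound_finite:
  assumes m: "intermediate m" and L: "intermediate L" and mL: "m \<subseteq> L" and gen_bound: "gen_bound m L c" and Y: "finite Y" "Y \<subseteq> L"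
  shows "\<exists>S\<subseteq>L. finite S \<and> card S \<le> c \<and> Y \<subseteq> adjoin m S"
proof -
  have Yc: "Y \<subseteq> carrier K" using Y intermediateD(3)[OF L] by blast
  have AL: "adjoin m Y \<subseteq> L" using mL Y L by (intro adjoin_min intermediateD)
  obtain S where S: "S \<subseteq> adjoin m Y" "finite S" "card S \<le> c" "adjoin m S = adjoin m Y"
    by (rule gen_boundD[OF gen_bound intermediate_adjoin[OF m Yc] adjoin_incl(1) AL finite_dimension_adjoin[OF m Y(1) Yc]])
  then show ?thesis using AL adjoin_incl(2)[of Y m] by (intro exI[of _ S]) auto
qed

text \<open>The finitely many elements to be generated involve only finitely many coefficients from \<open>m\<close>.\<close>

lemma gen_bound_trans:
  assumes k0: "intermediate k0" and m: "intermediate m" and L: "intermediate L" and "k0 \<subseteq> m" "m \<subseteq> L" and c: "gen_bound k0 m c" and d: "gen_bound m L d"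
  shows "gen_bound k0 L (c + d)"
proof (rule gen_boundI_finite[OF k0])
  fix Y assume Y: "finite Y" "Y \<subseteq> L"
  obtain S where S: "S \<subseteq> L" "finite S" "card S \<le> d" "Y \<subseteq> adjoin m S"
    using gen_bound_finite[OF m L assms(5) d Y] by blast
  have "\<forall>x\<in>Y. \<exists>A\<subseteq>m \<union> S. finite A \<and> x \<in> generate_field K A"
    using S(4) generate_field_finite_support unfolding adjoin_def by blast
  then obtain A where A: "\<And>x. x \<in> Y \<Longrightarrow> A x \<subseteq> m \<union> S \<and> finite (A x) \<and> x \<in> generate_field K (A x)"
    by metis
  define T where "T = (\<Union>x\<in>Y. A x) \<inter> m"
  have T: "finite T" "T \<subseteq> m" using A Y(1) by (auto simp: T_def)
  obtain T' where T': "T' \<subseteq> m" "finite T'" "card T' \<le> c" "T \<subseteq> adjoin k0 T'"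
    using gen_bound_finite[OF k0 m assms(4) c T] by blast
  have cc: "m \<subseteq> carrier K" "S \<subseteq> carrier K" "T' \<subseteq> carrier K" "k0 \<subseteq> carrier K" 
    using intermediateD(3) m L k0 S(1) T'(1) by blast+
  have ex: "intermediate (adjoin k0 (T' \<union> S))" using cc by (intro intermediate_adjoin k0) auto
  have "adjoin k0 T' \<subseteq> adjoin k0 (T' \<union> S)" using cc by (intro adjoin_mono) auto
  then have inc: "T \<subseteq> adjoin k0 (T' \<union> S)" "S \<subseteq> adjoin k0 (T' \<union> S)"
    using T'(4) adjoin_incl(2)[of "T' \<union> S" k0] by auto
  have "Y \<subseteq> adjoin k0 (T' \<union> S)"
  proof
    fix x assume x: "x \<in> Y"
    have "A x \<subseteq> T \<union> S" using A[OF x] x by (auto simp: T_def)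
    then have "A x \<subseteq> adjoin k0 (T' \<union> S)" using inc by blast
    moreover have "A x \<subseteq> carrier K" using A[OF x] cc by blast
    ultimately have "generate_field K (A x) \<subseteq> adjoin k0 (T' \<union> S)"
      using generate_field_min_subfield1[OF _ intermediateD(1)[OF ex]] by blast
    then show "x \<in> adjoin k0 (T' \<union> S)" using A[OF x] by blast
  qed
  moreover have "card (T' \<union> S) \<le> c + d" using card_Un_le[of T' S] T'(3) S(3) by linarith
  ultimately show "\<exists>S\<subseteq>carrier K. finite S \<and> card S \<le> c + d \<and> Y \<subseteq> adjoin k0 S"
    using cc T'(2) S(2) by (intro exI[of _ "T' \<union> S"]) auto
qed

lemma gen_bound_refl: "intermediate m \<Longrightarrow> gen_bound m m 0"
  unfolding gen_bound_def using adjoin_empty intermediateD(1) by (intro allI impI exI[of _ "{}"]) auto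

end

section \<open>The degree of irrationality\<close>

context purely_insep
begin

lemma generate_eq_adjoin: "generate_field K (k0 \<union> A \<union> B) = adjoin k0 (A \<union> B)"
  by (simp add: adjoin_def Un_assoc)

text \<open>By irredundance the greedy choice of a generating subset of a finite part of \<open>B\<close> discards nothing, so
such a part of size \<open>n\<close> gives a subextension of degree \<open>p\<^sup>n\<close>. This bounds \<open>n\<close>.\<close>

lemma r_base_deg:
  assumes k0: "intermediate k0" and E: "intermediate E" and "k0 \<subseteq> E" and fd: "finite_dimension k0 E"
    and B: "r_base K p k0 E B"
  shows "finite B" "deg (adjoin k0 (pow E 1)) E = p ^ card B"
proof -
  let ?Ep = "adjoin k0 (pow E 1)"
  have Ec: "E \<subseteq> carrier K" and kc: "k0 \<subseteq> carrier K" using intermediateD(3) E k0 by auto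
  have powc: "pow E 1 \<subseteq> carrier K" by (rule pow_carrier[OF Ec])
  have Ep: "intermediate ?Ep" by (rule intermediate_adjoin[OF k0 powc])
  have EpE: "?Ep \<subseteq> E" by (rule adjoin_min[OF intermediateD(1)[OF E] assms(3) pow_subset[OF intermediateD(1)[OF E]]])
  have fd': "finite_dimension ?Ep E" by (rule finite_dimension_between(2)[OF k0 Ep E adjoin_incl(1) EpE fd])
  have BE: "B \<subseteq> E" and gen: "E = adjoin ?Ep B"
    and irr: "\<And>x. x \<in> B \<Longrightarrow> x \<notin> adjoin ?Ep (B - {x})"
    using B Ec adjoin_adjoin[OF kc powc] unfolding r_base_def generate_eq_adjoin by (auto simp: subset_iff)
  have Bp: "x [^] p \<in> ?Ep" if "x \<in> B" for x
    using that BE adjoin_incl(2)[of "pow E 1" k0] by (auto simp: power_field_def)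
  have main: "p ^ card A = deg ?Ep (adjoin ?Ep A) \<and> deg ?Ep (adjoin ?Ep A) \<le> deg ?Ep E"
    if A: "finite A" "A \<subseteq> B" for A
  proof -
    have Ac: "A \<subseteq> carrier K" using A BE Ec by blast
    obtain A' where A': "A' \<subseteq> A" "adjoin ?Ep A' = adjoin ?Ep A" "finite_dimension ?Ep (adjoin ?Ep A)"
      "deg ?Ep (adjoin ?Ep A) = p ^ card A'"
      using exponent_one_basis[OF Ep A(1) Ac] Bp A(2) by blast
    have "A' = A"
    proof (rule ccontr)
      assume "A' \<noteq> A"
      then obtain x where x: "x \<in> A" "x \<notin> A'" using A'(1) by blast
      have "x \<in> adjoin ?Ep A'" using adjoin_incl(2)[of A ?Ep] x A'(2) by blast
      moreover have "adjoin ?Ep A' \<subseteq> adjoin ?Ep (B - {x})"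
        using A'(1) A(2) x BE Ec by (intro adjoin_mono[OF subset_refl _ intermediateD(3)[OF Ep]]) auto
      ultimately show False using irr[of x] x A(2) by blast
    qed
    moreover have "deg ?Ep (adjoin ?Ep A) \<le> deg ?Ep E"
    proof -
      have e: "intermediate (adjoin ?Ep A)" by (rule intermediate_adjoin[OF Ep Ac])
      have i: "adjoin ?Ep A \<subseteq> E" using A BE by (intro adjoin_min[OF intermediateD(1)[OF E] EpE]) auto
      note f = finite_dimension_between(2)[OF Ep e E adjoin_incl(1) i fd']
      show ?thesis using deg_tower(2)[OF Ep e A'(3) f] deg_pos[OF e E i f] by simp
    qed
    ultimately show ?thesis using A'(4) by simp
  qed
  show fin: "finite B"
  proof (rule finite_if_finite_subsets_card_bdd[THEN conjunct1])
    fix A assume A: "A \<subseteq> B" "finite A"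
    have "card A < p ^ card A" using p_gt_1 power_gt_expt[of p "card A"] by simp
    also have "\<dots> \<le> deg ?Ep E" using main[OF A(2,1)] by simp
    finally show "card A \<le> deg ?Ep E" by simp
  qed
  show "deg ?Ep E = p ^ card B" using main[OF fin subset_refl] gen by simp
qed

lemma r_base_card_le:
  assumes k0: "intermediate k0" and E: "intermediate E" and "k0 \<subseteq> E" and fd: "finite_dimension k0 E"
    and B: "r_base K p k0 E B" and S: "finite S" "S \<subseteq> E" "adjoin k0 S = E"
  shows "card B \<le> card S"
proof -
  let ?Ep = "adjoin k0 (pow E 1)"
  have Ec: "E \<subseteq> carrier K" using intermediateD(3) E by auto
  have powc: "pow E 1 \<subseteq> carrier K" by (rule pow_carrier[OF Ec])
  have Ep: "intermediate ?Ep" by (rule intermediate_adjoin[OF k0 powc])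
  have EpE: "?Ep \<subseteq> E" by (rule adjoin_min[OF intermediateD(1)[OF E] assms(3) pow_subset[OF intermediateD(1)[OF E]]])
  have Sc: "S \<subseteq> carrier K" using S Ec by auto
  have "adjoin ?Ep S = E"
    using adjoin_min[OF intermediateD(1)[OF E] EpE S(2)] S(3) 
      adjoin_mono[OF adjoin_incl(1)[of k0 "pow E 1"] subset_refl intermediateD(3)[OF Ep] Sc] by auto
  then have "deg ?Ep E \<le> p ^ card S"
    using exponent_one_deg_le[OF Ep S(1) Sc] pow_mono[OF S(2), of 1] adjoin_incl(2)[of "pow E 1" k0] by auto
  then show ?thesis using r_base_deg(2)[OF assms(1-5)] p_gt_1 by simp
qed

lemma r_base_exists:
  assumes k0: "intermediate k0" and E: "intermediate E" and "k0 \<subseteq> E" and fd: "finite_dimension k0 E"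
  shows "\<exists>B. r_base K p k0 E B \<and> finite B \<and> B \<subseteq> E \<and> adjoin k0 B = E"
proof -
  let ?Ep = "adjoin k0 (pow E 1)"
  have Ec: "E \<subseteq> carrier K" and kc: "k0 \<subseteq> carrier K" using intermediateD(3) E k0 by auto
  have powc: "pow E 1 \<subseteq> carrier K" by (rule pow_carrier[OF Ec])
  have Ep: "intermediate ?Ep" by (rule intermediate_adjoin[OF k0 powc])
  have EpE: "?Ep \<subseteq> E" by (rule adjoin_min[OF intermediateD(1)[OF E] assms(3) pow_subset[OF intermediateD(1)[OF E]]])
  have fd': "finite_dimension ?Ep E" by (rule finite_dimension_between(2)[OF k0 Ep E adjoin_incl(1) EpE fd])
  obtain B where B: "B \<subseteq> E" "finite B" "adjoin ?Ep B = E" "deg ?Ep E = p ^ card B"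
    using exponent_one_generators[OF Ep E EpE fd' adjoin_incl(2)] by blast
  obtain n where n: "pow E n \<subseteq> k0" using finite_dimension_exponent[OF k0 E assms(3) fd] by blast
  have "x \<notin> adjoin ?Ep (B - {x})" if x: "x \<in> B" for x
  proof
    assume "x \<in> adjoin ?Ep (B - {x})"
    then have "B \<subseteq> adjoin ?Ep (B - {x})" using adjoin_incl(2)[of "B - {x}" ?Ep] by auto
    moreover have Bxc: "B - {x} \<subseteq> carrier K" using B(1) Ec by auto
    ultimately have "E \<subseteq> adjoin ?Ep (B - {x})"
      using adjoin_min[OF intermediateD(1)[OF intermediate_adjoin[OF Ep Bxc]] adjoin_incl(1)] B(3) by metis
    moreover have "adjoin ?Ep (B - {x}) \<subseteq> E"
      using B(1) by (intro adjoin_min[OF intermediateD(1)[OF E] EpE]) auto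
    ultimately have "deg ?Ep E = deg ?Ep (adjoin ?Ep (B - {x}))" by auto
    also have "\<dots> \<le> p ^ card (B - {x})"
    proof (rule exponent_one_deg_le[OF Ep _ Bxc])
      show "finite (B - {x})" using B(2) by simp
      show "pow (B - {x}) 1 \<subseteq> ?Ep"
        using pow_mono[of "B - {x}" E 1] B(1) adjoin_incl(2)[of "pow E 1" k0] by auto
    qed
    also have "\<dots> < p ^ card B"
      using card_Diff1_less[OF B(2) x] p_gt_1 by (rule power_strict_increasing)
    finally show False using B(4) by simp
  qed
  then have "r_base K p k0 E B"
    using B(1,3) adjoin_adjoin[OF kc powc] Ec unfolding r_base_def generate_eq_adjoin
    by (auto simp: subset_iff)
  then show ?thesis using generators_mod_pth_powers[OF k0 E assms(3) B(1) n B(3)] B by blast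
qed

lemma finite_in_root:
  assumes m: "intermediate m" and Y: "finite Y" "Y \<subseteq> L" and L: "intermediate L"
  shows "\<exists>n\<ge>1. Y \<subseteq> root m L n"
proof -
  have Yc: "Y \<subseteq> carrier K" using Y(2) intermediateD(3)[OF L] by blast
  obtain n where n: "Y \<subseteq> root m (carrier K) n" using finite_exponent[OF m Y(1) Yc] by blast
  then have "Y \<subseteq> root m (carrier K) (Suc n)"
    using root_mono_exp[OF m subset_refl, of n "Suc n"] by simp
  then have "Y \<subseteq> root m L (Suc n)" using Y(2) unfolding root_field_def by blast
  then show ?thesis by (intro exI[of _ "Suc n"]) simp
qed

text \<open>An \<open>r\<close>-base of \<open>k\<^sub>n/k\<close> is a generating set of least size, and the fields \<open>k\<^sub>n\<close> exhaust \<open>K\<close>.\<close>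

proposition q_finite_iff_gen_bound:
  assumes lq: "lq_finite K p k (carrier K)"
  shows "q_finite K p k (carrier K) \<longleftrightarrow> (\<exists>c. gen_bound k (carrier K) c)"
proof -
  let ?R = "root k (carrier K)"
  let ?C = "{|B| | B n. n \<ge> 1 \<and> r_base K p k (?R n) B}"
  let ?\<kappa> = "degree_of_irrationality K p k (carrier K)"
  have fd: "finite_dimension k (?R n)" if "n \<ge> 1" for n using lq that by (simp add: lq_finite_def)
  have R: "intermediate (?R n)" for n by (rule intermediate_root[OF intermediate_ground intermediate_carrier])
  have kR: "k \<subseteq> ?R n" for n by (rule root_incl[OF intermediate_ground intermediateD(3)[OF intermediate_ground]])
  have "\<exists>\<kappa>. is_cardinal_sup ?C \<kappa>" by (rule is_cardinal_sup_ex) auto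
  then have sup: "is_cardinal_sup ?C ?\<kappa>"
    unfolding degree_of_irrationality_def by (rule someI_ex)
  then have co: "Card_order ?\<kappa>" by (simp add: is_cardinal_sup_def)
  have Fk: "|Field ?\<kappa>| =o ?\<kappa>" using card_of_Field_ordIso[OF co] .
  show ?thesis
  proof
    assume "q_finite K p k (carrier K)"
    then have fin: "finite (Field ?\<kappa>)" by (simp add: q_finite_def)
    have "gen_bound k (carrier K) (card (Field ?\<kappa>))"
    proof (rule gen_boundI_finite[OF intermediate_ground])
      fix Y assume Y: "finite Y" "Y \<subseteq> carrier K"
      obtain n where n: "n \<ge> 1" "Y \<subseteq> ?R n" using finite_in_root[OF intermediate_ground Y intermediate_carrier] by blast
      obtain B where B: "r_base K p k (?R n) B" "finite B" "B \<subseteq> ?R n" "adjoin k B = ?R n"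
        using r_base_exists[OF intermediate_ground R kR fd[OF n(1)]] by blast
      have "|B| \<le>o ?\<kappa>" using sup n(1) B(1) by (auto simp: is_cardinal_sup_def)
      then have "|B| \<le>o |Field ?\<kappa>|" using ordLeq_ordIso_trans ordIso_symmetric[OF Fk] by blast
      then have "card B \<le> card (Field ?\<kappa>)"
        using fin by (auto simp: card_of_ordLeq[symmetric] intro: card_inj_on_le)
      then show "\<exists>S\<subseteq>carrier K. finite S \<and> card S \<le> card (Field ?\<kappa>) \<and> Y \<subseteq> adjoin k S"
        using B(2,4) n(2) \<open>card B \<le> _\<close> subset_trans[OF B(3) root_subset] by (intro exI[of _ B]) auto
    qed
    then show "\<exists>c. gen_bound k (carrier K) c" by blast
  next
    assume "\<exists>c. gen_bound k (carrier K) c"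
    then obtain c where c: "gen_bound k (carrier K) c" by blast
    have le: "finite B \<and> card B \<le> c" if n1: "n \<ge> 1" and rB: "r_base K p k (?R n) B" for n B
    proof -
      obtain S where S: "S \<subseteq> ?R n" "finite S" "card S \<le> c" "adjoin k S = ?R n"
        by (rule gen_boundD[OF c R[of n] kR root_subset fd[OF n1]])
      show ?thesis
        using r_base_deg(1)[OF intermediate_ground R kR fd[OF n1] rB]
          r_base_card_le[OF intermediate_ground R kR fd[OF n1] rB S(2,1,4)] S(3) by simp
    qed
    have "finite (Field ?\<kappa>)"
    proof (cases "finite (UNIV :: 'a set)")
      case True
      then show ?thesis by (rule finite_subset[OF subset_UNIV])
    next
      case False
      \<comment> \<open>The competing bounds are cardinals on the type \<open>'a\<close>, so the number \<open>c\<close> is represented by a subset.\<close>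
      then obtain A :: "'a set" where A: "finite A" "card A = c"
        using infinite_arbitrarily_large by blast
      have "|B| \<le>o |A|" if "n \<ge> 1" "r_base K p k (?R n) B" for n B
        using le[OF that] A by (simp add: card_of_ordLeq[symmetric] inj_on_iff_card_le)
      then have "\<forall>c\<in>?C. c \<le>o |A|" by auto
      then have "?\<kappa> \<le>o |A|" using sup card_of_Card_order unfolding is_cardinal_sup_def by blast
      then have "|Field ?\<kappa>| \<le>o |A|" using Fk ordIso_ordLeq_trans by blast
      then show ?thesis using A(1) card_of_ordLeq_finite by blast
    qed
    then show "q_finite K p k (carrier K)" by (simp add: q_finite_def)
  qed
qed

end

section \<open>Descending chains of intermediate fields\<close>

locale abs_lq_finite = purely_insep +
  assumes abs_lq: "absolutely_lq_finite K p k (carrier K)"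
begin

lemma finite_dimension_root:
  assumes m: "intermediate m" and L: "intermediate L" and mL: "m \<subseteq> L"
  shows "finite_dimension m (root m L n)"
proof -
  have "lq_finite K p m (carrier K)"
    using abs_lq m intermediateD(2,3)[OF m] by (auto simp: absolutely_lq_finite_def intermediate_field_def intermediate_def)
  then have "finite_dimension m (root m (carrier K) (Suc n))" by (simp add: lq_finite_def)
  moreover have "root m L n \<subseteq> root m (carrier K) (Suc n)"
    using root_mono_exp[OF m subset_refl, of n "Suc n"] intermediateD(3)[OF L] unfolding root_field_def by auto
  ultimately show ?thesis
    using finite_dimension_between(1)[OF m intermediate_root[OF m L] intermediate_root[OF m intermediate_carrier] root_incl[OF m mL]] by blast
qed

text \<open>Let \<open>I\<close> be the intersection of a strictly descending chain. The elements of exponent at most one over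
\<open>I\<close> in the members of the chain form descending subfields of a finite extension of \<open>I\<close>. These are
stationary with intersection \<open>I\<close>, so some member has no element of exponent one over \<open>I\<close> and equals
\<open>I\<close>.\<close>

proposition minimal_intermediate_exists:
  assumes ne: "\<F> \<noteq> {}" and intermediate: "\<And>F. F \<in> \<F> \<Longrightarrow> intermediate F"
  shows "\<exists>M\<in>\<F>. \<forall>F\<in>\<F>. \<not> F \<subset> M"
proof (rule ccontr)
  assume "\<not> ?thesis"
  then have dc: "\<And>M. M \<in> \<F> \<Longrightarrow> \<exists>F\<in>\<F>. F \<subset> M" by blast
  have "\<exists>f :: nat \<Rightarrow> 'a set. \<forall>n. f n \<in> \<F> \<and> f (Suc n) \<subset> f n"
    by (rule dependent_nat_choice) (use ne dc in auto)
  then obtain f :: "nat \<Rightarrow> 'a set" where f: "\<And>n. f n \<in> \<F>" "\<And>n. f (Suc n) \<subset> f n" by blast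
  have anti: "f j \<subseteq> f i" if "i \<le> j" for i j
    by (rule lift_Suc_antimono_le[OF _ that]) (use f(2) in blast)
  have fe: "intermediate (f n)" for n using f intermediate by blast
  define I where "I = (\<Inter>n. f n)"
  have I: "intermediate I" unfolding I_def by (rule intermediate_Inter) (use fe in auto)
  have If: "I \<subseteq> f n" for n by (auto simp: I_def)
  define N where "N n = root I (f n) 1" for n
  have N: "intermediate (N n)" and IN: "I \<subseteq> N n" and fd: "finite_dimension I (N n)" for n
    unfolding N_def by (rule intermediate_root[OF I fe] root_incl[OF I If] finite_dimension_root[OF I fe If])+
  \<comment> \<open>From an index of minimal degree on, the chain \<open>N\<close> is constant.\<close>
  obtain i where i: "\<And>j. deg I (N i) \<le> deg I (N j)"
    using ex_has_least_nat[of "\<lambda>_. True" 0 "\<lambda>n. deg I (N n)"] by blast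
  have "N i \<subseteq> f j" for j
  proof (cases "i \<le> j")
    case True
    have sub: "N j \<subseteq> N i" using anti[OF True] by (auto simp: N_def root_mem)
    have fd': "finite_dimension (N j) (N i)" by (rule finite_dimension_between(2)[OF I N N IN sub fd])
    have "deg I (N j) * deg (N j) (N i) \<le> deg I (N j)"
      using deg_tower(2)[OF I N fd fd'] i[of j] by simp
    then have "deg (N j) (N i) = 1"
      using deg_pos[OF I N IN fd, of j] deg_pos[OF N N sub fd'] by simp
    then have "N i = N j" by (rule deg_eq_1[OF N N sub fd'])
    then show ?thesis by (simp add: N_def root_subset)
  next
    case False
    then show ?thesis using anti[of j i] root_subset by (auto simp: N_def root_mem)
  qed
  then have "N i \<subseteq> I" by (auto simp: I_def)
  have "I \<subset> f i" using If[of "Suc i"] f(2)[of i] by blast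
  then obtain x where x: "x \<in> f i" "x \<notin> I" "x [^] p \<in> I" using root_exists[OF I fe] by blast
  then have "x \<in> N i" by (simp add: N_def root_mem)
  then show False using x(2) \<open>N i \<subseteq> I\<close> by blast
qed

end

section \<open>Linear disjointness\<close>

context field
begin

lemma Span_mono_field:
  assumes C: "subfield C R" and E: "subfield E R" and "C \<subseteq> E" and us: "set us \<subseteq> carrier R"
  shows "Span C us \<subseteq> Span E us"
  unfolding Span_eq_combine_set[OF C us] Span_eq_combine_set[OF E us] using assms(3) by blast

lemma independent_mono_field:
  assumes C: "subfield C R" and E: "subfield E R" and "C \<subseteq> E" and ind: "independent E us"
  shows "independent C us"
  using ind
proof (induction us rule: list.induct)
  case (Cons u us)
  note b = independent_backwards[OF Cons.prems]
  have "u \<notin> Span C us"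
    using b(1) Span_mono_field[OF C E assms(3) independent_in_carrier[OF b(2)]] by blast
  then show ?case using Cons.IH[OF b(2)] b(3) by (intro li_Cons)
qed simp

lemma linearly_disjointD:
  "linearly_disjoint R C E F \<Longrightarrow> set us \<subseteq> E \<Longrightarrow> independent C us \<Longrightarrow> independent F us"
  unfolding linearly_disjoint_def by blast

text \<open>Inside \<open>E\<close>, a list independent over \<open>E\<close> has at most one entry.\<close>

lemma linearly_disjoint_self:
  assumes E: "subfield E R" and F: "subfield F R"
  shows "linearly_disjoint R E E F"
  unfolding linearly_disjoint_def
proof (intro allI impI, elim conjE)
  fix us assume us: "set us \<subseteq> E" "independent E us"
  have "length us \<le> 1"
    by (rule independent_length_le_dimension[OF E dimension_one[OF E] us(2,1)])
  then consider "us = []" | u where "us = [u]" by (cases us) auto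
  then show "independent F us"
  proof cases
    case 2
    have "u \<in> carrier R" "u \<notin> Span E []" using independent_backwards[of E u "[]"] us(2) 2 by auto
    then have "u \<notin> Span F []" by simp
    then show ?thesis unfolding 2 using \<open>u \<in> carrier R\<close> by (intro li_Cons li_Nil)
  qed simp
qed

text \<open>Interchange of summation: \<open>\<Sum>\<^sub>j c\<^sub>j (\<Sum>\<^sub>l A\<^sub>j\<^sub>l v\<^sub>l) = \<Sum>\<^sub>l (\<Sum>\<^sub>j A\<^sub>j\<^sub>l c\<^sub>j) v\<^sub>l\<close>.\<close>

lemma combine_matrix:
  assumes vs: "set vs \<subseteq> carrier R"
    and "length As = length cs" "set cs \<subseteq> carrier R"
    and "\<And>A. A \<in> set As \<Longrightarrow> set A \<subseteq> carrier R \<and> length A = length vs"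
  shows "\<exists>ks. length ks = length vs \<and> set ks \<subseteq> carrier R \<and>
     combine cs (map (\<lambda>A. combine A vs) As) = combine ks vs \<and>
     (\<forall>l<length vs. ks ! l = combine (map (\<lambda>A. A ! l) As) cs)"
  using assms(2-)
proof (induction As cs rule: list_induct2)
  case Nil
  show ?case using vs by (intro exI[of _ "replicate (length vs) \<zero>"]) (auto simp: combine_replicate)
next
  case (Cons A As c cs)
  have "set cs \<subseteq> carrier R" and c: "c \<in> carrier R"
    and "\<And>A. A \<in> set As \<Longrightarrow> set A \<subseteq> carrier R \<and> length A = length vs" using Cons.prems by auto
  from Cons.IH[OF this(1,3)]
  obtain ks where ks: "length ks = length vs" "set ks \<subseteq> carrier R"
     "combine cs (map (\<lambda>A. combine A vs) As) = combine ks vs"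
     "\<And>l. l < length vs \<Longrightarrow> ks ! l = combine (map (\<lambda>A. A ! l) As) cs" by blast
  have A: "set A \<subseteq> carrier R" "length A = length vs" using Cons.prems(2)[of A] by auto
  define k1 where "k1 = map ((\<otimes>) c) A"
  have k1: "set k1 \<subseteq> carrier R" "length k1 = length vs" using A c by (auto simp: k1_def)
  let ?ks = "map2 (\<oplus>) k1 ks"
  have "combine (c # cs) (map (\<lambda>A. combine A vs) (A # As)) = c \<otimes> combine A vs \<oplus> combine ks vs"
    using ks(3) by simp
  also have "c \<otimes> combine A vs = combine k1 vs"
    unfolding k1_def by (rule combine_r_distr[OF A(1) vs c])
  also have "combine k1 vs \<oplus> combine ks vs = combine ?ks vs"
    by (rule combine_add[OF k1(2) ks(1) k1(1) ks(2) vs])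
  finally have 1: "combine (c # cs) (map (\<lambda>A. combine A vs) (A # As)) = combine ?ks vs" .
  have 2: "?ks ! l = combine (map (\<lambda>A. A ! l) (A # As)) (c # cs)" if l: "l < length vs" for l
  proof -
    have "A ! l \<in> carrier R" using A l nth_mem by fastforce
    then show ?thesis using l k1(2) ks(1,4) A(2) c by (simp add: k1_def m_comm)
  qed
  have "a \<oplus> b \<in> carrier R" if "(a, b) \<in> set (zip k1 ks)" for a b
    using set_zip_leftD[OF that] set_zip_rightD[OF that] k1(1) ks(2) by blast
  then have 3: "set ?ks \<subseteq> carrier R" by auto
  show ?case using 1 2 3 k1(2) ks(1) by (intro exI[of _ ?ks]) auto
qed

text \<open>In a relation \<open>\<Sum>\<^sub>j u\<^sub>j c\<^sub>j = 0\<close> with \<open>u\<^sub>j \<in> E\<close> write the \<open>u\<^sub>j\<close> in a \<open>C\<close>-basis of their \<open>C\<close>-span.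
This basis stays independent over \<open>F\<close>, so its coefficients vanish; they are \<open>C\<close>-linear relations
between the \<open>c\<^sub>j\<close>.\<close>

lemma linearly_disjoint_sym:
  assumes C: "subfield C R" and E: "subfield E R" and F: "subfield F R" and CE: "C \<subseteq> E" and CF: "C \<subseteq> F"
    and ld: "linearly_disjoint R C E F"
  shows "linearly_disjoint R C F E"
  unfolding linearly_disjoint_def
proof (intro allI impI, elim conjE)
  fix cs assume cs: "set cs \<subseteq> F" "independent C cs"
  have csc: "set cs \<subseteq> carrier R" using cs(1) subfieldE(3)[OF F] by blast
  show "independent E cs"
  proof (rule ccontr)
    assume "\<not> independent E cs"
    then obtain us where us: "length us = length cs" "combine us cs = \<zero>" "set us \<subseteq> E" "set us \<noteq> {\<zero>}"
      using dependent_imp_non_trivial_combine[OF E csc] by metis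
    have usc: "set us \<subseteq> carrier R" using us(3) subfieldE(3)[OF E] by blast
    have comb_comm: "combine us cs = combine cs us" using us(1) usc csc
      by (induction us cs rule: list_induct2) (auto simp: m_comm)
    obtain vs where vs: "set vs \<subseteq> carrier R" "independent C vs" "Span C vs = Span C us"
      using filter_base[OF C usc] by blast
    have usV: "set us \<subseteq> Span C vs" using Span_base_incl[OF C usc] vs(3) by simp
    have "Span C us \<subseteq> Span E us" by (rule Span_mono_field[OF C E CE usc])
    also have "\<dots> \<subseteq> E"
    proof -
      have "subalgebra E E R" using subringE[OF subfieldE(1)[OF E]]
        by (intro subalgebra.intro subring.axioms(1) subalgebra_axioms.intro subfieldE(1)[OF E]) auto
      then show ?thesis using subalgebra_Span_incl[OF E _ us(3)] by blast
    qed
    finally have "set vs \<subseteq> E" using Span_base_incl[OF C vs(1)] vs(3) by blast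
    then have indF: "independent F vs" using linearly_disjointD[OF ld _ vs(2)] by blast
    have "\<forall>u\<in>set us. \<exists>A. set A \<subseteq> C \<and> length A = length vs \<and> u = combine A vs"
      using usV Span_mem_iff_length_version[OF C vs(1)] by blast
    then obtain A where A: "\<And>u. u \<in> set us \<Longrightarrow> set (A u) \<subseteq> C \<and> length (A u) = length vs \<and> u = combine (A u) vs"
      by metis
    have Cc: "C \<subseteq> carrier R" by (rule subfieldE(3)[OF C])
    have eq: "map (\<lambda>B. combine B vs) (map A us) = us" using A by (simp add: map_idI)
    obtain ks where ks: "length ks = length vs" "combine cs us = combine ks vs"
       "\<And>l. l < length vs \<Longrightarrow> ks ! l = combine (map (\<lambda>B. B ! l) (map A us)) cs"
      using combine_matrix[OF vs(1), of "map A us" cs] us(1) csc A Cc unfolding eq by fastforce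
    have Al: "set (map (\<lambda>B. B ! l) (map A us)) \<subseteq> C" if "l < length vs" for l
      using A that nth_mem by fastforce
    have CF': "combine Bs cs \<in> F" if "set Bs \<subseteq> C" for Bs
    proof -
      have "subalgebra C F R" using subringE[OF subfieldE(1)[OF F]] CF
        by (intro subalgebra.intro subring.axioms(1) subalgebra_axioms.intro subfieldE(1)[OF F]) auto
      then have "Span C cs \<subseteq> F" using subalgebra_Span_incl[OF C _ cs(1)] by blast
      then show ?thesis using that Span_eq_combine_set[OF C csc] by blast
    qed
    have "set ks \<subseteq> F"
      using ks(1,3) CF'[OF Al] by (metis in_set_conv_nth subsetI)
    then have "set (take (length vs) ks) \<subseteq> {\<zero>}"
      using independent_imp_trivial_combine[OF F indF] ks(2) us(2) comb_comm by simp
    then have k0: "ks ! l = \<zero>" if "l < length vs" for l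
      using that ks(1) nth_mem[of l ks] by (metis order_refl singletonD subsetD take_all)
    have Az: "A u ! l = \<zero>" if u: "u \<in> set us" and l: "l < length vs" for u l
    proof -
      let ?B = "map (\<lambda>B. B ! l) (map A us)"
      have "combine ?B cs = \<zero>" using k0[OF l] ks(3)[OF l] by simp
      then have "set (take (length cs) ?B) \<subseteq> {\<zero>}"
        by (rule independent_imp_trivial_combine[OF C cs(2) Al[OF l]])
      then have "set ?B \<subseteq> {\<zero>}" using us(1) by simp
      then show ?thesis using u by auto
    qed
    have "u = \<zero>" if u: "u \<in> set us" for u
    proof -
      have "A u = replicate (length vs) \<zero>" using A[OF u] Az[OF u] by (intro nth_equalityI) auto
      then show ?thesis using A[OF u] combine_replicate[OF vs(1)] by simp
    qed
    then have "us = []" using us(4) by (cases us) auto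
    then have "independent E cs" using us(1) by simp
    then show False using \<open>\<not> independent E cs\<close> by blast
  qed
qed

text \<open>In the symmetric form the coefficients lie in the fixed field \<open>E\<close>. If \<open>c\<close> is a combination of entries
that are independent over \<open>E\<close>, then its coefficients are unique; disjointness from each \<open>m\<close> puts them
into \<open>E \<inter> m\<close>, hence into the intersection.\<close>

lemma linearly_disjoint_Inter:
  assumes E: "subfield E R" and ne: "\<M> \<noteq> {}" and m: "\<And>m. m \<in> \<M> \<Longrightarrow> subfield m R"
    and ld: "\<And>m. m \<in> \<M> \<Longrightarrow> linearly_disjoint R (E \<inter> m) E m"
  shows "linearly_disjoint R (E \<inter> \<Inter>\<M>) E (\<Inter>\<M>)"
proof (rule linearly_disjoint_sym)
  let ?M = "\<Inter>\<M>"
  show M: "subfield ?M R" by (rule subfield_Inter[OF ne m])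
  then show EM: "subfield (E \<inter> ?M) R" by (rule subfield_Int[OF E])
  show "subfield E R" by fact
  show "linearly_disjoint R (E \<inter> ?M) ?M E"
    unfolding linearly_disjoint_def
  proof (intro allI impI, elim conjE)
    fix cs assume "set cs \<subseteq> ?M" "independent (E \<inter> ?M) cs"
    then show "independent E cs"
    proof (induction cs rule: list.induct)
      case (Cons c cs)
      note b = independent_backwards[OF Cons.prems(2)]
      have ind: "independent E cs" using Cons b(2) by simp
      note csc = independent_in_carrier[OF ind]
      have "c \<notin> Span E cs"
      proof
        assume c: "c \<in> Span E cs"
        have uniq: "\<exists>!Ks. set Ks \<subseteq> E \<and> length Ks = length cs \<and> c = combine Ks cs"
          by (rule unique_decomposition[OF E ind c])
        then obtain Ks where Ks: "set Ks \<subseteq> E" "length Ks = length cs" "c = combine Ks cs" by blast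
        have "set Ks \<subseteq> m" if mM: "m \<in> \<M>" for m
        proof -
          have Em: "subfield (E \<inter> m) R" by (rule subfield_Int[OF E m[OF mM]])
          have ind': "independent (E \<inter> m) cs" by (rule independent_mono_field[OF Em E _ ind]) simp
          have "linearly_disjoint R (E \<inter> m) m E"
            by (rule linearly_disjoint_sym[OF Em E m[OF mM] _ _ ld[OF mM]]) auto
          moreover have "\<not> independent E (c # cs)" using c independent_backwards(1) by blast
          moreover have "set (c # cs) \<subseteq> m" using Cons.prems(1) mM by blast
          ultimately have "\<not> independent (E \<inter> m) (c # cs)" using linearly_disjointD by blast
          then have "c \<in> Span (E \<inter> m) cs" using li_Cons[OF b(3) _ ind'] by blast
          then obtain Ks' where "set Ks' \<subseteq> E \<inter> m" "length Ks' = length cs" "c = combine Ks' cs"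
            using Span_mem_iff_length_version[OF Em csc] by blast
          moreover from this have "Ks' = Ks" using uniq Ks by blast
          ultimately show ?thesis by blast
        qed
        then have "set Ks \<subseteq> E \<inter> ?M" using Ks(1) by blast
        then have "c \<in> Span (E \<inter> ?M) cs"
          using Span_mem_iff_length_version[OF EM csc] Ks by blast
        then show False using b(1) by blast
      qed
      then show ?case using ind b(3) by (intro li_Cons)
    qed simp
  qed
qed auto

end

section \<open>Modular extensions and the smallest modular subfield\<close>

context purely_insep
begin

text \<open>For \<open>n \<ge> 1\<close> the field \<open>L\<^bsup>p^n\<^esup>\<close> is contained in \<open>m\<close> and is compared with \<open>m\<close> over itself.\<close>

lemma modular_exponent_one:
  assumes m: "intermediate m" and L: "intermediate L" and "m \<subseteq> L" and pw: "pow L 1 \<subseteq> m"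
  shows "modular_extension K p m L"
  unfolding modular_extension_def
proof
  fix n
  show "linearly_disjoint K (pow L n \<inter> m) (pow L n) m"
  proof (cases n)
    case 0
    have "pow L 0 \<inter> m = m" using assms(3) pow_0[OF intermediateD(3)[OF L]] by auto
    then show ?thesis unfolding 0 by (simp add: linearly_disjoint_def)
  next
    case (Suc n')
    then have "pow L n \<inter> m = pow L n"
      using pow_antimono[OF intermediateD(1)[OF L], of 1 n] pw by auto
    then show ?thesis
      using linearly_disjoint_self[OF pow_subfield[OF intermediateD(1)[OF L]] intermediateD(1)[OF m]] by simp
  qed
qed

lemma modular_self: "intermediate L \<Longrightarrow> modular_extension K p L L"
  using modular_exponent_one[of L L] pow_subset[OF intermediateD(1)] by simp

text \<open>The intersection of all \<open>m\<close> with \<open>L/m\<close> modular is again one of them, so the least such field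
exists.\<close>

lemma smallest_modular_subfield:
  assumes L: "intermediate L"
  defines "M \<equiv> smallest_modular_subfield K p k L"
  shows "intermediate M" "M \<subseteq> L" "modular_extension K p M L"
    and "\<And>m. intermediate m \<Longrightarrow> m \<subseteq> L \<Longrightarrow> modular_extension K p m L \<Longrightarrow> M \<subseteq> m"
proof -
  let ?P = "\<lambda>m. intermediate_field K k L m \<and> modular_extension K p m L"
  have P: "?P m \<longleftrightarrow> intermediate m \<and> m \<subseteq> L \<and> modular_extension K p m L" for m
    by (auto simp: intermediate_field_def intermediate_def)
  define \<M> where "\<M> = {m. ?P m}"
  have M\<M>: "m \<in> \<M> \<longleftrightarrow> ?P m" for m by (simp add: \<M>_def)
  have ne: "\<M> \<noteq> {}" using L modular_self P M\<M> by blast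
  have sub: "\<And>m. m \<in> \<M> \<Longrightarrow> subfield m K" using P M\<M> intermediateD(1) by blast
  have ld: "linearly_disjoint K (pow L n \<inter> m) (pow L n) m" if "m \<in> \<M>" for m n
    using that unfolding M\<M> modular_extension_def by blast
  have "intermediate (\<Inter>\<M>) \<and> \<Inter>\<M> \<subseteq> L \<and> modular_extension K p (\<Inter>\<M>) L"
  proof (intro conjI)
    show "intermediate (\<Inter>\<M>)" using P M\<M> by (intro intermediate_Inter[OF ne]) blast
    show "\<Inter>\<M> \<subseteq> L" using ne P M\<M> by blast
    show "modular_extension K p (\<Inter>\<M>) L"
      unfolding modular_extension_def
    proof
      fix n
      show "linearly_disjoint K (pow L n \<inter> \<Inter>\<M>) (pow L n) (\<Inter>\<M>)"
        by (rule linearly_disjoint_Inter[OF pow_subfield[OF intermediateD(1)[OF L]] ne sub ld])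
    qed
  qed
  then have PM: "?P (\<Inter>\<M>)" by (rule P[THEN iffD2])
  then have "M = \<Inter>\<M>"
    unfolding M_def smallest_modular_subfield_def by (intro Least_equality) (auto simp: M\<M>)
  then show "intermediate M" "M \<subseteq> L" "modular_extension K p M L"
    "\<And>m. intermediate m \<Longrightarrow> m \<subseteq> L \<Longrightarrow> modular_extension K p m L \<Longrightarrow> M \<subseteq> m"
    using PM P M\<M> by auto
qed

end

context abs_lq_finite
begin

text \<open>Let \<open>F\<close> be a root field \<open>m\<^sub>n\<close>. Linear disjointness of \<open>L\<^sup>p\<close> and \<open>m\<close> gives
\<open>[m(F\<^sup>p) : m] \<ge> [F\<^sup>p : F\<^sup>p \<inter> m] = [F : m\<^sub>1]\<close>, whence \<open>[F : m(F\<^sup>p)] \<le> [m\<^sub>1 : m]\<close>. This number is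
finite and does not depend on \<open>n\<close>; it is a generous bound for its own logarithm.\<close>

proposition modular_imp_gen_bound:
  assumes m: "intermediate m" and L: "intermediate L" and mL: "m \<subseteq> L" and mod: "modular_extension K p m L"
  shows "\<exists>c. gen_bound m L c"
proof -
  have Lc: "L \<subseteq> carrier K" and mc: "m \<subseteq> carrier K" using intermediateD(3) m L by auto
  let ?R = "root m L"
  have R: "intermediate (?R n)" and mR: "m \<subseteq> ?R n" and fdR: "finite_dimension m (?R n)" for n
    by (rule intermediate_root[OF m L] root_incl[OF m mL] finite_dimension_root[OF m L mL])+
  let ?r = "deg m (?R 1)"
  have "gen_bound m L ?r"
  proof (rule gen_boundI_finite[OF m])
    fix Y assume Y: "finite Y" "Y \<subseteq> L"
    obtain n where n: "n \<ge> 1" "Y \<subseteq> ?R n" using finite_in_root[OF m Y L] by blast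
    let ?F = "?R n"
    let ?A = "adjoin m (pow ?F 1)"
    have FL: "?F \<subseteq> L" by (rule root_subset)
    have powc: "pow ?F 1 \<subseteq> carrier K" by (rule pow_carrier[OF intermediateD(3)[OF R]])
    have A: "intermediate ?A" by (rule intermediate_adjoin[OF m powc])
    have AF: "?A \<subseteq> ?F" by (rule adjoin_min[OF intermediateD(1)[OF R] mR pow_subset[OF intermediateD(1)[OF R]]])
    have fdA: "finite_dimension m ?A" and fdAF: "finite_dimension ?A ?F"
      using finite_dimension_between[OF m A R adjoin_incl(1) AF fdR] by auto
    have R1F: "?R 1 \<subseteq> ?F" by (rule root_mono_exp[OF m Lc n(1)])
    have fdRF: "finite_dimension (?R 1) ?F" by (rule finite_dimension_between(2)[OF m R R mR R1F fdR])
    let ?D = "deg (?R 1) ?F"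
    let ?C = "pow L 1 \<inter> m"
    have C: "subfield ?C K" by (rule subfield_Int[OF pow_subfield[OF intermediateD(1)[OF L]] intermediateD(1)[OF m]])
    have CR: "pow (?R 1) 1 = ?C" by (auto simp: power_field_def root_mem)
    have "dimension ?D ?C (pow ?F 1)"
      using dimension_pow[OF intermediateD(1)[OF R] deg_dimension[OF R fdRF], of 1] unfolding CR .
    then obtain us where us: "set us \<subseteq> carrier K" "independent ?C us" "length us = ?D" "Span ?C us = pow ?F 1"
      using exists_base[OF C] by blast
    have usF: "set us \<subseteq> pow ?F 1" using Span_base_incl[OF C us(1)] us(4) by simp
    have "linearly_disjoint K ?C (pow L 1) m" using mod by (auto simp: modular_extension_def)
    then have "independent m us"
      using linearly_disjointD[OF _ _ us(2)] usF pow_mono[OF FL, of 1] by blast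
    from independent_length_le_dimension[OF intermediateD(1)[OF m] deg_dimension[OF m fdA] this
        subset_trans[OF usF adjoin_incl(2)]]
    have "?D \<le> deg m ?A" unfolding us(3) .
    moreover have "?r * ?D = deg m ?A * deg ?A ?F"
      using deg_tower(2)[OF m R fdR fdRF] deg_tower(2)[OF m A fdA fdAF] by simp
    moreover have "deg m ?A > 0" by (rule deg_pos[OF m A adjoin_incl(1) fdA])
    ultimately have "deg m ?A * deg ?A ?F \<le> deg m ?A * ?r"
      by (metis mult.commute mult_le_mono1)
    then have le: "deg ?A ?F \<le> ?r" using \<open>deg m ?A > 0\<close> by simp
    obtain B where B: "r_base K p m ?F B" "finite B" "B \<subseteq> ?F" "adjoin m B = ?F"
      using r_base_exists[OF m R mR fdR] by blast
    have "card B < p ^ card B" using p_gt_1 power_gt_expt[of p "card B"] by simp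
    also have "\<dots> \<le> ?r" using le r_base_deg(2)[OF m R mR fdR B(1)] by simp
    finally have "card B \<le> ?r" by simp
    moreover have "B \<subseteq> carrier K" using B(3) intermediateD(3)[OF R] by blast
    ultimately show "\<exists>S\<subseteq>carrier K. finite S \<and> card S \<le> ?r \<and> Y \<subseteq> adjoin m S"
      using B(2,4) n(2) by (intro exI[of _ B]) auto
  qed
  then show ?thesis by blast
qed

text \<open>A minimal intermediate field \<open>L\<close> without a generator bound over \<open>k\<close> would be modular over a proper
subfield, which has a bound over \<open>k\<close> by minimality.\<close>

proposition gen_bound_if_smallest_modular_proper:
  assumes proper: "\<And>L. intermediate L \<Longrightarrow> L \<noteq> k \<Longrightarrow> smallest_modular_subfield K p k L \<noteq> L"
  shows "\<exists>c. gen_bound k (carrier K) c"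
proof (rule ccontr)
  assume n: "\<not> ?thesis"
  let ?\<F> = "{L. intermediate L \<and> \<not> (\<exists>c. gen_bound k L c)}"
  have "?\<F> \<noteq> {}" using n intermediate_carrier by blast
  then obtain L where L: "intermediate L" "\<not> (\<exists>c. gen_bound k L c)" and min: "\<And>F. F \<in> ?\<F> \<Longrightarrow> \<not> F \<subset> L"
    using minimal_intermediate_exists[of ?\<F>] by blast
  have "L \<noteq> k" using L(2) gen_bound_refl[OF intermediate_ground] by blast
  let ?M = "smallest_modular_subfield K p k L"
  note M = smallest_modular_subfield[OF L(1)]
  have "?M \<subset> L" using proper[OF L(1) \<open>L \<noteq> k\<close>] M(2) by blast
  then obtain c where c: "gen_bound k ?M c" using min[of ?M] M(1) by blast
  obtain d where "gen_bound ?M L d" using modular_imp_gen_bound[OF M(1) L(1) M(2,3)] by blast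
  then have "gen_bound k L (c + d)" by (rule gen_bound_trans[OF intermediate_ground M(1) L(1) intermediateD(2)[OF M(1)] M(2) c])
  then show False using L(2) by blast
qed

end

section \<open>A degree criterion for modularity\<close>

lemma (in ring) Span_dimension_le:
  assumes F: "subfield F R" and us: "set us \<subseteq> carrier R"
  shows "\<exists>d. dimension d F (Span F us) \<and> d \<le> length us \<and> (d = length us \<longrightarrow> independent F us)"
  using us
proof (induction us rule: list.induct)
  case Nil
  show ?case by (intro exI[of _ 0]) auto
next
  case (Cons u us)
  then obtain d where d: "dimension d F (Span F us)" "d \<le> length us" "d = length us \<longrightarrow> independent F us"
    and u: "u \<in> carrier R" "set us \<subseteq> carrier R" by auto
  show ?case
  proof (cases "u \<in> Span F us")
    case True
    have "Span F (u # us) \<subseteq> Span F us"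
      using True Span_base_incl[OF F u(2)] u(2) by (intro mono_Span_subset[OF F]) auto
    then have "Span F (u # us) = Span F us" using mono_Span[OF F u(2,1)] by (rule equalityI)
    then show ?thesis using d by (intro exI[of _ d]) (auto simp del: Span.simps)
  next
    case False
    have "dimension (Suc d) F (line_extension F u (Span F us))"
      by (rule Suc_dim[OF u(1) False d(1)])
    then have "dimension (Suc d) F (Span F (u # us))" by simp
    then show ?thesis using d False u(1)
      by (intro exI[of _ "Suc d"]) (auto simp del: Span.simps intro: li_Cons)
  qed
qed

context purely_insep
begin

lemma intermediate_Union_chain:
  assumes f: "\<And>n::nat. intermediate (f n)" and mono: "\<And>n. f n \<subseteq> f (Suc n)"
  shows "intermediate (\<Union>n. f n)"
proof (rule subring_intermediate)
  have le: "f i \<subseteq> f j" if "i \<le> j" for i j using mono that by (rule lift_Suc_mono_le)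
  have two: "\<exists>n. x \<in> f n \<and> y \<in> f n" if xy: "x \<in> (\<Union>n. f n)" "y \<in> (\<Union>n. f n)" for x y
  proof -
    obtain i j where "x \<in> f i" "y \<in> f j" using xy by blast
    then show ?thesis using le[of i "max i j"] le[of j "max i j"] by (intro exI[of _ "max i j"]) auto
  qed
  note r = subringE[OF intermediateD(4)[OF f]]
  show "subring (\<Union>n. f n) K"
  proof (rule subringI)
    show "(\<Union>n. f n) \<subseteq> carrier K" using r(1) by blast
    show "\<one> \<in> (\<Union>n. f n)" using r(3) by blast
    show "\<ominus> h \<in> (\<Union>n. f n)" if "h \<in> (\<Union>n. f n)" for h using that r(5) by blast
    show "h1 \<otimes> h2 \<in> (\<Union>n. f n)" "h1 \<oplus> h2 \<in> (\<Union>n. f n)" if h: "h1 \<in> (\<Union>n. f n)" "h2 \<in> (\<Union>n. f n)" for h1 h2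
    proof -
      obtain n where n: "h1 \<in> f n" "h2 \<in> f n" using two[OF h] by blast
      show "h1 \<otimes> h2 \<in> (\<Union>n. f n)" using r(6)[OF n] by (rule UN_I[OF UNIV_I])
      show "h1 \<oplus> h2 \<in> (\<Union>n. f n)" using r(7)[OF n] by (rule UN_I[OF UNIV_I])
    qed
  qed
  show "k \<subseteq> (\<Union>n. f n)" using intermediateD(2)[OF f] by blast
qed

lemma deg_adjoin_le:
  assumes F: "intermediate F" and S: "finite S" "S \<subseteq> carrier K" "pow S r \<subseteq> F"
  shows "deg F (adjoin F S) \<le> p ^ (r * card S)"
  using F S(3)
proof (induction r arbitrary: F)
  case 0
  then have "adjoin F S = F" using pow_0[OF S(2)] intermediateD(1) by (intro adjoin_absorb) auto
  then show ?case using 0 by (simp add: deg_refl)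
next
  case (Suc r)
  let ?M = "adjoin F (pow S r)"
  have powc: "pow S r \<subseteq> carrier K" by (rule pow_carrier[OF S(2)])
  have M: "intermediate ?M" by (rule intermediate_adjoin[OF Suc.prems(1) powc])
  have E: "intermediate (adjoin F S)" by (rule intermediate_adjoin[OF Suc.prems(1) S(2)])
  have fin: "finite (pow S r)" and cr: "card (pow S r) \<le> card S"
    using S(1) by (auto simp: power_field_def card_image_le)
  have pS: "pow S r \<subseteq> adjoin F S"
    using pow_mono[OF adjoin_incl(2)[of S F], of r] pow_subset[OF intermediateD(1)[OF E]] by blast
  have "adjoin ?M S = adjoin (adjoin F S) (pow S r)"
    using adjoin_adjoin[OF intermediateD(3)[OF Suc.prems(1)]] powc S(2) by (simp add: Un_commute)
  also have "\<dots> = adjoin F S" by (rule adjoin_absorb[OF intermediateD(1)[OF E] pS])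
  finally have eq: "adjoin ?M S = adjoin F S" .
  have "pow (pow S r) 1 \<subseteq> F" using Suc.prems(2) pow_add[OF S(2), of r 1] by simp
  then have "deg F ?M \<le> p ^ card (pow S r)" by (rule exponent_one_deg_le[OF Suc.prems(1) fin powc])
  also have "\<dots> \<le> p ^ card S" using cr p_pos by (intro power_increasing) auto
  finally have 1: "deg F ?M \<le> p ^ card S" .
  have 2: "deg ?M (adjoin F S) \<le> p ^ (r * card S)"
    using Suc.IH[OF M adjoin_incl(2)] unfolding eq .
  have "deg F (adjoin F S) = deg F ?M * deg ?M (adjoin F S)"
    using deg_tower(2)[OF Suc.prems(1) M finite_dimension_adjoin[OF Suc.prems(1) fin powc] finite_dimension_adjoin[OF M S(1,2)]]
    unfolding eq .
  also have "\<dots> \<le> p ^ card S * p ^ (r * card S)" by (rule mult_le_mono[OF 1 2])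
  finally show ?case by (simp add: power_add)
qed

text \<open>Products of entries of \<open>ws\<close> lie in the field \<open>D\<close>, hence in their own span. So the span over \<open>m\<close> is a
ring; it is the compositum of \<open>m\<close> and \<open>D\<close>.\<close>

lemma Span_intermediate:
  assumes m: "intermediate m" and C: "subfield C K" "C \<subseteq> m" and D: "subfield D K" "Span C ws = D"
    and ws: "set ws \<subseteq> carrier K"
  shows "intermediate (Span m ws)" "m \<subseteq> Span m ws"
proof -
  let ?V = "Span m ws"
  have mF: "subfield m K" and mc: "m \<subseteq> carrier K" using intermediateD[OF m] by auto
  have Vc: "?V \<subseteq> carrier K" by (rule Span_subgroup_props(1)[OF mF ws])
  have DV: "D \<subseteq> ?V" using Span_mono_field[OF C(1) mF C(2) ws] D(2) by simp
  have wsD: "set ws \<subseteq> D" using Span_base_incl[OF C(1) ws] D(2) by simp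
  have sm: "c \<otimes> v \<in> ?V" if "c \<in> m" "v \<in> ?V" for c v by (rule Span_smult_closed[OF mF ws that])
  have add: "u \<oplus> v \<in> ?V" if "u \<in> ?V" "v \<in> ?V" for u v by (rule Span_subgroup_props(3)[OF mF ws that])
  have z: "\<zero> \<in> ?V" by (rule Span_subgroup_props(2)[OF mF ws])
  have comb: "combine cs vs \<in> ?V" if "set cs \<subseteq> m" "set vs \<subseteq> ?V" for cs vs
    using that by (induction cs vs rule: combine.induct) (auto simp: z add sm simp del: Span.simps)
  have comb2: "combine cs vs \<otimes> v \<in> ?V"
    if "set cs \<subseteq> m" "set vs \<subseteq> carrier K" "v \<in> carrier K" "\<And>w. w \<in> set vs \<Longrightarrow> w \<otimes> v \<in> ?V" for cs vs v
  proof -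
    have "combine cs vs \<otimes> v = combine cs (map (\<lambda>w. w \<otimes> v) vs)"
      using that mc by (intro combine_l_distr) auto
    also have "\<dots> \<in> ?V" using that by (intro comb) auto
    finally show ?thesis .
  qed
  have wv: "v \<otimes> w \<in> ?V" if v: "v \<in> ?V" and w: "w \<in> set ws" for v w
  proof -
    obtain cs where cs: "set cs \<subseteq> m" "v = combine cs ws" using v Span_eq_combine_set[OF mF ws] by blast
    have "w' \<otimes> w \<in> ?V" if "w' \<in> set ws" for w'
      using that w wsD DV subringE(6)[OF subfieldE(1)[OF D(1)], of w' w] by blast
    then show ?thesis using cs ws w by (auto intro!: comb2 simp del: Span.simps)
  qed
  have mult: "u \<otimes> v \<in> ?V" if u: "u \<in> ?V" and v: "v \<in> ?V" for u v
  proof -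
    obtain cs where cs: "set cs \<subseteq> m" "u = combine cs ws" using u Span_eq_combine_set[OF mF ws] by blast
    have "w \<otimes> v \<in> ?V" if w: "w \<in> set ws" for w
    proof -
      have "w \<otimes> v = v \<otimes> w" using v w Vc ws by (intro m_comm) blast+
      then show ?thesis using wv[OF v w] by simp
    qed
    then show ?thesis using cs ws v Vc by (auto intro!: comb2 simp del: Span.simps)
  qed
  have one: "\<one> \<in> ?V" using DV subringE(3)[OF subfieldE(1)[OF D(1)]] by blast
  show mV: "m \<subseteq> ?V"
  proof
    fix c assume c: "c \<in> m"
    then show "c \<in> ?V" using sm[OF c one] mc by auto
  qed
  have "subring ?V K"
  proof (rule subringI)
    show "\<ominus> h \<in> ?V" if h: "h \<in> ?V" for h
    proof -
      have "\<ominus> \<one> \<in> m" using subringE(3,5)[OF intermediateD(4)[OF m]] by blast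
      then have "\<ominus> \<one> \<otimes> h \<in> ?V" using sm h by blast
      then show ?thesis using h Vc l_minus[of \<one> h] by (auto simp del: Span.simps)
    qed
  qed (use Vc one mult add in \<open>blast+\<close>)
  then show "intermediate ?V" using intermediateD(2)[OF m] mV by (intro subring_intermediate) auto
qed

end

context abs_lq_finite
begin

text \<open>The degree of \<open>m\<^sub>i\<^bsup>p^r\<^esup>\<close> over \<open>L\<^bsup>p^r\<^esup> \<inter> m = m\<^sub>r\<^bsup>p^r\<^esup>\<close> is \<open>[m\<^sub>i : m\<^sub>r] = p\<^bsup>e(i-r)\<^esup>\<close>. As \<open>m\<^sub>i\<close> arises
from \<open>A = m(m\<^sub>i\<^bsup>p^r\<^esup>)\<close> by adjoining \<open>e\<close> elements whose \<open>p^r\<close>-th powers are in \<open>A\<close>, we have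
\<open>[m\<^sub>i : A] \<le> p\<^bsup>er\<^esup>\<close>, so \<open>[A : m] \<ge> p\<^bsup>e(i-r)\<^esup>\<close>. Hence a basis of \<open>m\<^sub>i\<^bsup>p^r\<^esup>\<close>, which spans \<open>A\<close> over
\<open>m\<close>, remains independent over \<open>m\<close>.\<close>

proposition modular_if_equiexponential:
  assumes m: "intermediate m" and L: "intermediate L" and mL: "m \<subseteq> L" and gen_bound: "gen_bound m L e"
    and dg: "\<And>i. deg m (root m L i) = p ^ (e * i)"
  shows "modular_extension K p m L"
  unfolding modular_extension_def
proof
  fix r
  let ?R = "root m L"
  have Lc: "L \<subseteq> carrier K" by (rule intermediateD(3)[OF L])
  have mF: "subfield m K" by (rule intermediateD(1)[OF m])
  have R: "intermediate (?R n)" and mR: "m \<subseteq> ?R n" and fdR: "finite_dimension m (?R n)" for n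
    by (rule intermediate_root[OF m L] root_incl[OF m mL] finite_dimension_root[OF m L mL])+
  have Rmono: "?R i \<subseteq> ?R j" if "i \<le> j" for i j by (rule root_mono_exp[OF m Lc that])
  let ?C = "pow L r \<inter> m"
  have C: "subfield ?C K" by (rule subfield_Int[OF pow_subfield[OF intermediateD(1)[OF L]] mF])
  have CR: "pow (?R r) r = ?C" by (auto simp: power_field_def root_mem)
  show "linearly_disjoint K ?C (pow L r) m"
    unfolding linearly_disjoint_def
  proof (intro allI impI, elim conjE)
    fix us assume us: "set us \<subseteq> pow L r" "independent ?C us"
    obtain Y where Y: "finite Y" "Y \<subseteq> L" "set us = pow Y r"
      using finite_subset_image[OF finite_set us(1)[unfolded power_field_def]] unfolding power_field_def by blast
    obtain n where n: "Y \<subseteq> ?R n" using finite_in_root[OF m Y(1,2) L] by blast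
    define i where "i = max n r"
    have i: "r \<le> i" "Y \<subseteq> ?R i" using n Rmono[of n i] by (auto simp: i_def)
    let ?D = "pow (?R i) r"
    have D: "subfield ?D K" by (rule pow_subfield[OF intermediateD(1)[OF R]])
    have usD: "set us \<subseteq> ?D" using Y(3) pow_mono[OF i(2)] by simp
    have fdri: "finite_dimension (?R r) (?R i)" by (rule finite_dimension_between(2)[OF m R R mR Rmono[OF i(1)] fdR])
    let ?N = "p ^ (e * (i - r))"
    have "p ^ (e * r) * deg (?R r) (?R i) = p ^ (e * i)"
      using deg_tower(2)[OF m R fdR fdri] dg by simp
    also have "\<dots> = p ^ (e * r) * ?N"
      using i(1) by (simp add: power_add[symmetric] distrib_left[symmetric])
    finally have "deg (?R r) (?R i) = ?N" using p_pos by simp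
    then have "dimension ?N ?C ?D"
      using dimension_pow[OF intermediateD(1)[OF R] deg_dimension[OF R fdri], of r] unfolding CR by simp
    from complete_base[OF C this us(2) usD] obtain Vs
      where ws: "length (Vs @ us) = ?N" "independent ?C (Vs @ us)" "Span ?C (Vs @ us) = ?D" by blast
    let ?ws = "Vs @ us"
    have wsc: "set ?ws \<subseteq> carrier K" by (rule independent_in_carrier[OF ws(2)])
    have CD: "?C \<subseteq> m" by simp
    note V = Span_intermediate[OF m C CD D ws(3) wsc]
    let ?V = "Span m ?ws"
    have "?D \<subseteq> ?V" using Span_mono_field[OF C mF CD wsc] ws(3) by simp
    let ?A = "adjoin m ?D"
    have Dc: "?D \<subseteq> carrier K" by (rule subfieldE(3)[OF D])
    have A: "intermediate ?A" by (rule intermediate_adjoin[OF m Dc])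
    have AV: "?A \<subseteq> ?V" by (rule adjoin_min[OF intermediateD(1)[OF V(1)] V(2) \<open>?D \<subseteq> ?V\<close>])
    have AR: "?A \<subseteq> ?R i" by (rule adjoin_min[OF intermediateD(1)[OF R] mR pow_subset[OF intermediateD(1)[OF R]]])
    have fdA: "finite_dimension m ?A" and fdAR: "finite_dimension ?A (?R i)"
      using finite_dimension_between[OF m A R adjoin_incl(1) AR fdR] by auto
    obtain S where S: "S \<subseteq> ?R i" "finite S" "card S \<le> e" "adjoin m S = ?R i"
      by (rule gen_boundD[OF gen_bound R mR root_subset fdR])
    have Sc: "S \<subseteq> carrier K" using S(1) intermediateD(3)[OF R] by blast
    have "adjoin ?A S = ?R i"
      using adjoin_min[OF intermediateD(1)[OF R] AR S(1)] S(4)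
        adjoin_mono[OF adjoin_incl(1)[of m ?D] subset_refl intermediateD(3)[OF A] Sc] by auto
    then have "deg ?A (?R i) \<le> p ^ (r * card S)"
      using deg_adjoin_le[OF A S(2) Sc subset_trans[OF pow_mono[OF S(1)] adjoin_incl(2)]] by simp
    also have "\<dots> \<le> p ^ (e * r)" using S(3) p_pos by (intro power_increasing) (auto simp: mult.commute)
    finally have le: "deg ?A (?R i) \<le> p ^ (e * r)" .
    have "p ^ (e * r) * ?N = p ^ (e * i)"
      using i(1) by (simp add: power_add[symmetric] distrib_left[symmetric])
    also have "\<dots> = deg m ?A * deg ?A (?R i)"
      using deg_tower(2)[OF m A fdA fdAR] dg by simp
    also have "\<dots> \<le> deg m ?A * p ^ (e * r)" using le by simp
    finally have "?N \<le> deg m ?A" using p_pos by (simp add: mult.commute)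
    obtain d where d: "dimension d m ?V" "d \<le> length ?ws" "d = length ?ws \<longrightarrow> independent m ?ws"
      using Span_dimension_le[OF mF wsc] by blast
    have fdV: "finite_dimension m ?V" by (rule finite_dimensionI[OF d(1)])
    have fdAV: "finite_dimension ?A ?V" by (rule finite_dimension_between(2)[OF m A V(1) adjoin_incl(1) AV fdV])
    have "d = deg m ?A * deg ?A ?V" using degI[OF m d(1)] deg_tower(2)[OF m A fdA fdAV] by simp
    then have "deg m ?A \<le> d" using deg_pos[OF A V(1) AV fdAV] by simp
    then have "d = length ?ws" using \<open>?N \<le> deg m ?A\<close> d(2) ws(1) by linarith
    then show "independent m us" using d(3) independent_split(1)[OF mF] by blast
  qed
qed

end

section \<open>Extensions over which an extension is modular\<close>

context abs_lq_finite
begin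

lemma unbounded_exponent_element:
  assumes m: "intermediate m" and S: "intermediate S" "S \<subseteq> L" and unb: "\<not> S \<subseteq> root m L n"
  shows "\<exists>x\<in>S. x \<in> root m L (Suc n) \<and> x \<notin> root m L n"
proof -
  obtain y where y: "y \<in> S" "y \<notin> root m L n" using unb by blast
  then have yn: "y [^] (p ^ n) \<notin> m" and yc: "y \<in> carrier K" using S intermediateD(3)[OF S(1)] by (auto simp: root_mem)
  obtain N where "y [^] (p ^ N) \<in> k" using pi yc by (auto simp: purely_inseparable_def)
  then have ex: "\<exists>N. y [^] (p ^ N) \<in> m" using intermediateD(2)[OF m] by blast
  define N where "N = (LEAST N. y [^] (p ^ N) \<in> m)"
  have N: "y [^] (p ^ N) \<in> m" using LeastI_ex[OF ex] by (simp add: N_def)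
  have Nmin: "y [^] (p ^ i) \<notin> m" if "i < N" for i using that not_less_Least unfolding N_def by blast
  have "n < N"
  proof (rule ccontr)
    assume "\<not> n < N"
    then obtain d where "n = N + d" using le_Suc_ex[of N n] by auto
    then have "y [^] (p ^ n) = (y [^] (p ^ N)) [^] (p ^ d)" using yc by (simp add: nat_pow_pow power_add)
    then show False using yn subfield_pow_closed[OF intermediateD(1)[OF m] N] by simp
  qed
  let ?x = "y [^] (p ^ (N - Suc n))"
  have pw: "?x [^] (p ^ i) = y [^] (p ^ (N - Suc n + i))" for i using yc by (simp add: nat_pow_pow power_add)
  have xS: "?x \<in> S" by (rule subfield_pow_closed[OF intermediateD(1)[OF S(1)] y(1)])
  moreover have "?x [^] (p ^ Suc n) \<in> m" using pw[of "Suc n"] N \<open>n < N\<close> by simp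
  moreover have "?x [^] (p ^ n) \<notin> m" using pw[of n] Nmin[of "N - Suc n + n"] \<open>n < N\<close> by simp
  ultimately show ?thesis using S(2) by (auto simp: root_mem)
qed

text \<open>For \<open>F = m\<^bsub>n+1\<^esub>\<close> the field \<open>m(F\<^sup>p)\<close> lies in \<open>m\<^sub>n\<close>, so an element of \<open>S\<close> of exact exponent \<open>n + 1\<close>
is outside \<open>m(F\<^sup>p)\<close> and can be chosen as the first member of a minimal generating set of \<open>F/m\<close>. The
remaining members generate a field containing \<open>F\<close> over \<open>S\<close>.\<close>

proposition gen_bound_decreases:
  assumes m: "intermediate m" and S: "intermediate S" and L: "intermediate L" and mS: "m \<subseteq> S" and SL: "S \<subseteq> L"
    and gen_bound: "gen_bound m L e" and unb: "\<And>n. \<not> S \<subseteq> root m L n"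
  shows "\<exists>e'<e. gen_bound S L e'"
proof -
  let ?R = "root m L"
  have Lc: "L \<subseteq> carrier K" by (rule intermediateD(3)[OF L])
  have mL: "m \<subseteq> L" using mS SL by blast
  have R: "intermediate (?R n)" and mR: "m \<subseteq> ?R n" and fdR: "finite_dimension m (?R n)" for n
    by (rule intermediate_root[OF m L] root_incl[OF m mL] finite_dimension_root[OF m L mL])+
  have key: "\<exists>B\<subseteq>carrier K. finite B \<and> card B < e \<and> ?R (Suc n) \<subseteq> adjoin S B" for n
  proof -
    let ?F = "?R (Suc n)"
    let ?A = "adjoin m (pow ?F 1)"
    have Fc: "?F \<subseteq> carrier K" by (rule intermediateD(3)[OF R])
    have powc: "pow ?F 1 \<subseteq> carrier K" by (rule pow_carrier[OF Fc])
    have A: "intermediate ?A" by (rule intermediate_adjoin[OF m powc])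
    have AF: "?A \<subseteq> ?F" by (rule adjoin_min[OF intermediateD(1)[OF R] mR pow_subset[OF intermediateD(1)[OF R]]])
    have fdAF: "finite_dimension ?A ?F" by (rule finite_dimension_between(2)[OF m A R adjoin_incl(1) AF fdR])
    obtain x where x: "x \<in> S" "x \<in> ?F" "x \<notin> ?R n"
      using unbounded_exponent_element[OF m S SL unb] by blast
    have xc: "x \<in> carrier K" using x(2) Fc by blast
    have "pow ?F 1 \<subseteq> ?R n"
    proof
      fix z assume "z \<in> pow ?F 1"
      then obtain y where y: "y \<in> ?F" "z = y [^] p" by (auto simp: power_field_def)
      then have "y \<in> carrier K" using Fc by blast
      then have "z [^] (p ^ n) \<in> m" using y by (simp add: root_mem nat_pow_pow)
      moreover have "z \<in> L" using y subfield_pow_closed[OF intermediateD(1)[OF L]] by (auto simp: root_mem)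
      ultimately show "z \<in> ?R n" by (simp add: root_mem)
    qed
    then have "?A \<subseteq> ?R n" by (rule adjoin_min[OF intermediateD(1)[OF R] mR])
    then have xA: "x \<notin> ?A" using x(3) by blast
    have "x [^] p \<in> pow ?F 1" using x(2) by (auto simp: power_field_def)
    then have xp: "x [^] p \<in> ?A" using adjoin_incl(2) by blast
    note st = deg_adjoin_pth_root[OF A xc xA xp]
    let ?E = "adjoin ?A {x}"
    have E: "intermediate ?E" using xc by (intro intermediate_adjoin[OF A]) simp
    have EF: "?E \<subseteq> ?F" using x(2) by (intro adjoin_min[OF intermediateD(1)[OF R] AF]) simp
    have fdEF: "finite_dimension ?E ?F" by (rule finite_dimension_between(2)[OF A E R adjoin_incl(1) EF fdAF])
    have "pow ?F 1 \<subseteq> ?E" using adjoin_incl(2)[of "pow ?F 1" m] adjoin_incl(1)[of ?A "{x}"] by blast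
    then obtain B where B: "B \<subseteq> ?F" "finite B" "adjoin ?E B = ?F" "deg ?E ?F = p ^ card B"
      using exponent_one_generators[OF E R EF fdEF] by blast
    have Bc: "B \<subseteq> carrier K" using B(1) Fc by blast
    obtain T where T: "T \<subseteq> ?F" "finite T" "card T \<le> e" "adjoin m T = ?F"
      by (rule gen_boundD[OF gen_bound R mR root_subset fdR])
    have Tc: "T \<subseteq> carrier K" using T(1) Fc by blast
    have "adjoin ?A T = ?F"
      using adjoin_min[OF intermediateD(1)[OF R] AF T(1)] T(4)
        adjoin_mono[OF adjoin_incl(1)[of m "pow ?F 1"] subset_refl intermediateD(3)[OF A] Tc] by auto
    then have "deg ?A ?F \<le> p ^ card T"
      using exponent_one_deg_le[OF A T(2) Tc subset_trans[OF pow_mono[OF T(1)] adjoin_incl(2)]] by simp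
    also have "\<dots> \<le> p ^ e" using T(3) p_pos by (intro power_increasing) auto
    finally have "p ^ Suc (card B) \<le> p ^ e" using deg_tower(2)[OF A E st(1) fdEF] st(2) B(4) by simp
    then have "card B < e" using p_gt_1 by (metis Suc_le_eq power_le_imp_le_exp)
    have xBF: "insert x B \<subseteq> ?F" using x(2) B(1) by blast
    have "adjoin ?A (insert x B) = ?F"
      using B(3) adjoin_adjoin[OF intermediateD(3)[OF A], of "{x}" B] xc Bc by simp
    then have "adjoin m (insert x B) = ?F"
      by (rule generators_mod_pth_powers[OF m R mR xBF pow_root_subset])
    moreover have "adjoin m (insert x B) \<subseteq> adjoin S B"
      using x(1) mS adjoin_incl(1)[of S B] adjoin_incl(2)[of B S]
      by (intro adjoin_min intermediateD(1)[OF intermediate_adjoin[OF S Bc]]) blast+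
    ultimately show ?thesis using Bc B(2) \<open>card B < e\<close> by blast
  qed
  have "e > 0" using key[of 0] by (metis gr_implies_not0 gr0I)
  have "gen_bound S L (e - 1)"
  proof (rule gen_boundI_finite[OF S])
    fix Y assume Y: "finite Y" "Y \<subseteq> L"
    obtain n where n: "n \<ge> 1" "Y \<subseteq> ?R n" using finite_in_root[OF m Y L] by blast
    obtain B where "B \<subseteq> carrier K" "finite B" "card B < e" "?R (Suc (n - 1)) \<subseteq> adjoin S B"
      using key by blast
    then show "\<exists>B\<subseteq>carrier K. finite B \<and> card B \<le> e - 1 \<and> Y \<subseteq> adjoin S B"
      using n by (intro exI[of _ B]) auto
  qed
  then show ?thesis using \<open>e > 0\<close> by (intro exI[of _ "e - 1"]) simp
qed

end

text \<open>The defects \<open>e - d i\<close> are natural numbers with bounded partial sums, so almost all of them vanish.\<close>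

lemma eventually_full:
  fixes d :: "nat \<Rightarrow> nat"
  assumes le: "\<And>i. d i \<le> e" and sum: "\<And>j. e * j \<le> (\<Sum>i<j. d i) + c"
  shows "\<exists>n. \<forall>j\<ge>n. d j = e"
proof -
  have "finite {i. d i < e} \<and> card {i. d i < e} \<le> c"
  proof (rule finite_if_finite_subsets_card_bdd)
    fix G assume G: "G \<subseteq> {i. d i < e}" "finite G"
    obtain j where j: "G \<subseteq> {..<j}" using G(2) finite_nat_iff_bounded by blast
    have "(\<Sum>i<j. d i) + card G = (\<Sum>i<j. d i + (if i \<in> G then 1 else 0))"
      using j by (simp add: sum.distrib sum.If_cases Int_absorb1)
    also have "\<dots> \<le> (\<Sum>i<j. e)"
      using le G(1) by (intro sum_mono) (auto simp: Suc_le_eq)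
    finally show "card G \<le> c" using sum[of j] by (simp add: mult.commute)
  qed
  then obtain n where "{i. d i < e} \<subseteq> {..<n}" using finite_nat_iff_bounded by blast
  then have "\<not> d j < e" if "j \<ge> n" for j using that by (auto simp: subset_iff not_less[symmetric])
  then have "d j = e" if "j \<ge> n" for j using that le[of j] by (meson nat_less_le)
  then show ?thesis by blast
qed

context abs_lq_finite
begin

text \<open>Writing \<open>m\<^sub>j\<close> for \<open>root m L j\<close>, this is the subfield \<open>m(m\<^bsub>u+d\<^esub>\<^bsup>p^d\<^esup>)\<close> of \<open>m\<^sub>u\<close>, which shrinks as \<open>d\<close>
grows.\<close>

definition deep_part :: "'a set \<Rightarrow> 'a set \<Rightarrow> nat \<Rightarrow> nat \<Rightarrow> 'a set" where
  "deep_part m L u d = adjoin m (pow (root m L (u + d)) d)"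

definition divisible_part :: "'a set \<Rightarrow> 'a set \<Rightarrow> nat \<Rightarrow> 'a set" where
  "divisible_part m L u = (\<Inter>d. deep_part m L u d)"

context
  fixes m L
  assumes m: "intermediate m" and L: "intermediate L" and mL: "m \<subseteq> L"
begin

lemma L_carrier: "L \<subseteq> carrier K" by (rule intermediateD(3)[OF L])

lemma roots_intermediate: "intermediate (root m L n)" and subset_roots: "m \<subseteq> root m L n" and roots_finite_dimension: "finite_dimension m (root m L n)"
  by (rule intermediate_root[OF m L] root_incl[OF m mL] finite_dimension_root[OF m L mL])+

lemma roots_mono: "i \<le> j \<Longrightarrow> root m L i \<subseteq> root m L j"
  by (rule root_mono_exp[OF m L_carrier])

lemma pow_roots: "pow (root m L (u + d)) d \<subseteq> root m L u"
proof
  fix z assume "z \<in> pow (root m L (u + d)) d"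
  then obtain y where y: "y \<in> root m L (u + d)" "z = y [^] (p ^ d)" by (auto simp: power_field_def)
  then have "y \<in> carrier K" using L_carrier by (auto simp: root_mem)
  then have "z [^] (p ^ u) = y [^] (p ^ (u + d))" using y by (simp add: nat_pow_pow power_add mult.commute)
  moreover have "z \<in> L" using y subfield_pow_closed[OF intermediateD(1)[OF L]] by (auto simp: root_mem)
  ultimately show "z \<in> root m L u" using y(1) by (simp add: root_mem)
qed

lemma pow_roots_carrier: "pow (root m L j) d \<subseteq> carrier K"
  by (rule pow_carrier[OF intermediateD(3)[OF roots_intermediate]])

lemma adjoin_pow_roots: "intermediate (adjoin m (pow (root m L j) d))"
  by (rule intermediate_adjoin[OF m pow_roots_carrier])

lemma deep_part_intermediate: "intermediate (deep_part m L u d)"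
  unfolding deep_part_def by (rule adjoin_pow_roots)

lemma deep_part_subset_roots: "deep_part m L u d \<subseteq> root m L u"
  unfolding deep_part_def by (rule adjoin_min[OF intermediateD(1)[OF roots_intermediate] subset_roots pow_roots])

lemma deep_part_antimono: "deep_part m L u (Suc d) \<subseteq> deep_part m L u d"
proof -
  have "pow (root m L (u + Suc d)) (1 + d) = pow (pow (root m L (u + d + 1)) 1) d"
    using pow_add[OF intermediateD(3)[OF roots_intermediate], of "u + Suc d" 1 d] by simp
  also have "\<dots> \<subseteq> pow (root m L (u + d)) d" by (rule pow_mono[OF pow_roots])
  finally show ?thesis unfolding deep_part_def
    using adjoin_mono[OF subset_refl _ intermediateD(3)[OF m] pow_roots_carrier] by simp
qed

lemma deep_part_shift: "deep_part m L u (Suc d) \<subseteq> deep_part m L (Suc u) d"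
  unfolding deep_part_def
  using adjoin_mono[OF subset_refl pow_antimono[OF intermediateD(1)[OF roots_intermediate], of d "Suc d"] intermediateD(3)[OF m] pow_roots_carrier]
  by simp

lemma deep_part_stationary: "\<exists>d. divisible_part m L u = deep_part m L u d"
proof -
  obtain d where d: "\<And>d'. \<not> deep_part m L u d' \<subset> deep_part m L u d"
    using minimal_intermediate_exists[of "range (deep_part m L u)"] deep_part_intermediate by auto
  have anti: "deep_part m L u j \<subseteq> deep_part m L u i" if "i \<le> j" for i j
    using deep_part_antimono that by (rule lift_Suc_antimono_le)
  have "deep_part m L u d \<subseteq> deep_part m L u d'" for d'
    using anti[of d d'] anti[of d' d] d[of d'] by (cases "d \<le> d'") auto
  then have "divisible_part m L u = deep_part m L u d" unfolding divisible_part_def by blast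
  then show ?thesis ..
qed

lemma divisible_part_intermediate: "intermediate (divisible_part m L u)"
  using deep_part_stationary[of u] deep_part_intermediate by metis

lemma divisible_part_mono: "divisible_part m L u \<subseteq> divisible_part m L (Suc u)"
  unfolding divisible_part_def using deep_part_shift by blast

lemma divisible_union_intermediate: "intermediate (\<Union>u. divisible_part m L u)"
  by (rule intermediate_Union_chain) (rule divisible_part_intermediate, rule divisible_part_mono)

lemma divisible_union_subset: "(\<Union>u. divisible_part m L u) \<subseteq> L"
proof (rule UN_least)
  fix u
  have "divisible_part m L u \<subseteq> deep_part m L u 0" unfolding divisible_part_def by (rule INF_lower) simp
  also have "\<dots> \<subseteq> L" by (rule subset_trans[OF deep_part_subset_roots root_subset])
  finally show "divisible_part m L u \<subseteq> L" .
qed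

lemma subset_divisible_union: "m \<subseteq> (\<Union>u. divisible_part m L u)"
proof -
  have "m \<subseteq> divisible_part m L 0"
    unfolding divisible_part_def deep_part_def by (rule INF_greatest) (rule adjoin_incl(1))
  then show ?thesis by blast
qed

text \<open>If \<open>x\<close> has exact exponent \<open>n + 1 + d\<close> over \<open>m\<close>, then \<open>x\<^bsup>p^d\<^esup>\<close> has exact exponent \<open>n + 1\<close> and
lies in \<open>deep_part m L (Suc n) d\<close>. For suitable \<open>d\<close> this field is the divisible part.\<close>

lemma divisible_union_unbounded:
  assumes unb: "\<And>n. \<not> L \<subseteq> root m L n"
  shows "\<not> (\<Union>u. divisible_part m L u) \<subseteq> root m L n"
proof
  assume sub: "(\<Union>u. divisible_part m L u) \<subseteq> root m L n"
  obtain d where d: "divisible_part m L (Suc n) = deep_part m L (Suc n) d" using deep_part_stationary by blast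
  obtain x where x: "x \<in> L" "x \<in> root m L (Suc (n + d))" "x \<notin> root m L (n + d)"
    using unbounded_exponent_element[OF m L subset_refl unb] by blast
  have xc: "x \<in> carrier K" using x(1) L_carrier by blast
  have "x [^] (p ^ d) \<in> pow (root m L (Suc n + d)) d" using x(2) by (auto simp: power_field_def)
  then have "x [^] (p ^ d) \<in> divisible_part m L (Suc n)"
    unfolding d deep_part_def using adjoin_incl(2) by blast
  then have "x [^] (p ^ d) \<in> root m L n" using sub by blast
  then have "x [^] (p ^ (n + d)) \<in> m" using xc by (simp add: root_mem nat_pow_pow power_add mult.commute)
  then show False using x(1,3) by (simp add: root_mem)
qed

text \<open>With \<open>R = m\<^bsub>u+d\<^esub>\<close>, each field \<open>m(R\<^bsup>p^i\<^esup>)\<close> with \<open>i \<le> d\<close> contains \<open>Y\<close> and so needs at least \<open>e\<close>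
generators. Therefore its degree over the next field \<open>m(R\<^bsup>p^(i+1)\<^esup>)\<close> is at least \<open>p\<^sup>e\<close>.\<close>

lemma deg_lower_bound:
  assumes Y: "Y \<subseteq> divisible_part m L u"
    and no: "\<And>B. B \<subseteq> carrier K \<Longrightarrow> finite B \<Longrightarrow> card B < e \<Longrightarrow> \<not> Y \<subseteq> adjoin m B"
  shows "p ^ (e * d) \<le> deg m (root m L (u + d))"
proof -
  let ?R = "root m L (u + d)"
  let ?G = "\<lambda>i. adjoin m (pow ?R i)"
  have GR: "?G i \<subseteq> ?R" for i
    by (rule adjoin_min[OF intermediateD(1)[OF roots_intermediate] subset_roots pow_subset[OF intermediateD(1)[OF roots_intermediate]]])
  have fdG: "finite_dimension m (?G i)" and fdGR: "finite_dimension (?G i) ?R" for i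
    using finite_dimension_between[OF m adjoin_pow_roots roots_intermediate adjoin_incl(1) GR roots_finite_dimension] by auto
  have Gmono: "?G j \<subseteq> ?G i" if "i \<le> j" for i j
    by (rule adjoin_mono[OF subset_refl pow_antimono[OF intermediateD(1)[OF roots_intermediate] that] intermediateD(3)[OF m] pow_roots_carrier])
  have fdS: "finite_dimension (?G (Suc i)) (?G i)" for i
    by (rule finite_dimension_between(1)[OF adjoin_pow_roots adjoin_pow_roots roots_intermediate _ GR fdGR]) (rule Gmono, simp)
  have layer: "p ^ e \<le> deg (?G (Suc i)) (?G i)" if i: "i \<le> d" for i
  proof -
    have YG: "Y \<subseteq> ?G i"
    proof -
      have "Y \<subseteq> deep_part m L u d" using Y by (auto simp: divisible_part_def)
      also have "\<dots> \<subseteq> ?G i" unfolding deep_part_def by (rule Gmono[OF i])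
      finally show ?thesis .
    qed
    obtain B where B: "r_base K p m (?G i) B" "finite B" "B \<subseteq> ?G i" "adjoin m B = ?G i"
      using r_base_exists[OF m adjoin_pow_roots adjoin_incl(1) fdG] by blast
    have "B \<subseteq> carrier K" using B(3) intermediateD(3)[OF adjoin_pow_roots] by blast
    then have "e \<le> card B" using no[of B] B(2,4) YG by (metis not_less)
    then have "p ^ e \<le> p ^ card B" using p_pos by (intro power_increasing) auto
    also have "\<dots> = deg (adjoin m (pow (?G i) 1)) (?G i)"
      by (rule r_base_deg(2)[OF m adjoin_pow_roots adjoin_incl(1) fdG B(1), symmetric])
    also have "adjoin m (pow (?G i) 1) = ?G (Suc i)"
    proof
      have pS: "pow ?R (Suc i) = pow (pow ?R i) 1" using pow_add[OF intermediateD(3)[OF roots_intermediate], of "u + d" i 1] by simp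
      have "pow (?G i) 1 \<subseteq> ?G (Suc i)"
        by (rule pow_adjoin_subset[OF adjoin_pow_roots intermediateD(3)[OF m] pow_roots_carrier])
          (use pow_subset[OF intermediateD(1)[OF m], of 1] adjoin_incl(1)[of m] adjoin_incl(2)[of "pow ?R (Suc i)" m] pS in auto)
      then show "adjoin m (pow (?G i) 1) \<subseteq> ?G (Suc i)"
        by (rule adjoin_min[OF intermediateD(1)[OF adjoin_pow_roots] adjoin_incl(1)])
      show "?G (Suc i) \<subseteq> adjoin m (pow (?G i) 1)"
        unfolding pS
        by (rule adjoin_mono[OF subset_refl pow_mono[OF adjoin_incl(2)] intermediateD(3)[OF m] pow_carrier[OF intermediateD(3)[OF adjoin_pow_roots]]])
    qed
    finally show ?thesis .
  qed
  have "p ^ (e * i) \<le> deg (?G i) ?R" if "i \<le> d" for i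
    using that
  proof (induction i)
    case 0
    show ?case using deg_pos[OF adjoin_pow_roots roots_intermediate GR fdGR] by (simp add: Suc_le_eq)
  next
    case (Suc i)
    have "p ^ (e * Suc i) = p ^ e * p ^ (e * i)" by (simp add: power_add)
    also have "\<dots> \<le> deg (?G (Suc i)) (?G i) * deg (?G i) ?R"
      using Suc layer[of i] by (intro mult_le_mono) auto
    also have "\<dots> = deg (?G (Suc i)) ?R"
      by (rule deg_tower(2)[OF adjoin_pow_roots adjoin_pow_roots fdS fdGR, symmetric])
    finally show ?case .
  qed
  from this[OF order_refl] have "p ^ (e * d) \<le> deg (?G d) ?R" .
  also have "\<dots> \<le> deg m (?G d) * deg (?G d) ?R"
    using deg_pos[OF m adjoin_pow_roots adjoin_incl(1) fdG, of d] by simp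
  also have "\<dots> = deg m ?R" by (rule deg_tower(2)[OF m adjoin_pow_roots fdG fdGR, symmetric])
  finally show ?thesis .
qed

text \<open>The layers \<open>m\<^bsub>i+1\<^esub>/m\<^sub>i\<close> have degrees \<open>p\<^bsup>d i\<^esup>\<close> with \<open>d i \<le> e\<close>, while the lower bound for the degree
of \<open>m\<^bsub>u+d\<^esub>\<close> over \<open>m\<close> bounds the sum of the defects \<open>e - d i\<close> by \<open>e u\<close>.\<close>

lemma eventually_equiexponential:
  assumes gen_bound: "gen_bound m L e" and Y: "Y \<subseteq> divisible_part m L u"
    and no: "\<And>B. B \<subseteq> carrier K \<Longrightarrow> finite B \<Longrightarrow> card B < e \<Longrightarrow> \<not> Y \<subseteq> adjoin m B"
  shows "\<exists>n. \<forall>i. deg (root m L n) (root m L (n + i)) = p ^ (e * i)"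
proof -
  let ?R = "root m L"
  have fdRR: "finite_dimension (?R i) (?R j)" if "i \<le> j" for i j
    by (rule finite_dimension_between(2)[OF m roots_intermediate roots_intermediate subset_roots roots_mono[OF that] roots_finite_dimension])
  have "\<exists>d\<le>e. deg (?R i) (?R (Suc i)) = p ^ d" for i
  proof -
    have ps: "pow (?R (Suc i)) 1 \<subseteq> ?R i" using pow_roots[of i 1] by simp
    obtain B where B: "B \<subseteq> ?R (Suc i)" "finite B" "adjoin (?R i) B = ?R (Suc i)" "deg (?R i) (?R (Suc i)) = p ^ card B"
      using exponent_one_generators[OF roots_intermediate roots_intermediate roots_mono fdRR ps] by auto
    obtain S where S: "S \<subseteq> ?R (Suc i)" "finite S" "card S \<le> e" "adjoin m S = ?R (Suc i)"
      by (rule gen_boundD[OF gen_bound roots_intermediate subset_roots root_subset roots_finite_dimension])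
    have Sc: "S \<subseteq> carrier K" using S(1) intermediateD(3)[OF roots_intermediate] by blast
    have RS: "?R i \<subseteq> ?R (Suc i)" by (rule roots_mono) simp
    have "adjoin (?R i) S = ?R (Suc i)"
      using adjoin_min[OF intermediateD(1)[OF roots_intermediate] RS S(1)] S(4)
        adjoin_mono[OF subset_roots subset_refl intermediateD(3)[OF roots_intermediate] Sc, of i] by auto
    then have "deg (?R i) (?R (Suc i)) \<le> p ^ card S"
      using exponent_one_deg_le[OF roots_intermediate S(2) Sc subset_trans[OF pow_mono[OF S(1)] ps]] by simp
    then have "card B \<le> card S" using B(4) p_gt_1 by simp
    then show ?thesis using B(4) S(3) by (intro exI[of _ "card B"]) simp
  qed
  then obtain d where d: "\<And>i. d i \<le> e" "\<And>i. deg (?R i) (?R (Suc i)) = p ^ d i" by metis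
  have deg_sum: "deg (?R n) (?R (n + j)) = p ^ (\<Sum>i<j. d (n + i))" for n j
  proof (induction j)
    case (Suc j)
    have "deg (?R n) (?R (n + Suc j)) = deg (?R n) (?R (n + j)) * deg (?R (n + j)) (?R (n + Suc j))"
      by (rule deg_tower(2)[OF roots_intermediate roots_intermediate fdRR fdRR]) auto
    then show ?case using Suc d(2)[of "n + j"] by (simp add: power_add)
  qed (simp add: deg_refl[OF roots_intermediate])
  have m0: "?R 0 = m" by (rule root_0[OF m L_carrier mL])
  have "e * j \<le> (\<Sum>i<j. d i) + e * u" for j
  proof (cases "u \<le> j")
    case True
    then obtain l where l: "j = u + l" using le_Suc_ex by blast
    have "p ^ (e * l) \<le> deg m (?R (u + l))" using Y no by (rule deg_lower_bound)
    then have "p ^ (e * l) \<le> p ^ (\<Sum>i<j. d i)"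
      using deg_sum[of 0 j] m0 l by simp
    then have "e * l \<le> (\<Sum>i<j. d i)" using p_gt_1 by simp
    then show ?thesis by (simp add: l distrib_left)
  next
    case False
    then have "e * j \<le> e * u" by simp
    then show ?thesis by linarith
  qed
  then obtain n where n: "\<And>j. j \<ge> n \<Longrightarrow> d j = e" using eventually_full[of d e "e * u", OF d(1)] by blast
  have "deg (?R n) (?R (n + i)) = p ^ (e * i)" for i
    using deg_sum[of n i] n by (simp add: mult.commute)
  then show ?thesis by blast
qed

end

text \<open>When \<open>m(L\<^sup>p) = L\<close> for all proper \<open>m\<close>, the choice of \<open>m\<close> with the least possible generator bound
forces every field of unbounded exponent between \<open>m\<close> and \<open>L\<close> to be \<open>L\<close>, in particular the union of
the divisible parts. So already some divisible part needs \<open>e\<close> generators, and \<open>L\<close> is modular over a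
root field of \<open>m\<close>.\<close>

proposition proper_modular_subfield_exists:
  assumes L: "intermediate L" and "L \<noteq> k" and gen_bound: "gen_bound k L c"
  shows "\<exists>m. intermediate m \<and> m \<subset> L \<and> modular_extension K p m L"
proof (cases "\<exists>m. intermediate m \<and> m \<subset> L \<and> adjoin m (pow L 1) \<noteq> L")
  case True
  then obtain m where m: "intermediate m" "m \<subset> L" "adjoin m (pow L 1) \<noteq> L" by blast
  let ?A = "adjoin m (pow L 1)"
  have A: "intermediate ?A" by (rule intermediate_adjoin[OF m(1) pow_carrier[OF intermediateD(3)[OF L]]])
  have AL: "?A \<subseteq> L" using m(2) by (intro adjoin_min[OF intermediateD(1)[OF L] _ pow_subset[OF intermediateD(1)[OF L]]]) auto
  show ?thesis using modular_exponent_one[OF A L AL adjoin_incl(2)] A AL m(3) by blast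
next
  case False
  then have perfect: "adjoin m (pow L 1) = L" if "intermediate m" "m \<subset> L" for m using that by blast
  have "k \<subset> L" using intermediateD(2)[OF L] assms(2) by blast
  then have ex: "\<exists>e m. intermediate m \<and> m \<subset> L \<and> gen_bound m L e" using intermediate_ground gen_bound by blast
  define e where "e = (LEAST e. \<exists>m. intermediate m \<and> m \<subset> L \<and> gen_bound m L e)"
  obtain m where m: "intermediate m" "m \<subset> L" "gen_bound m L e"
    using LeastI_ex[OF ex] unfolding e_def by blast
  have min: "\<not> gen_bound m' L e'" if "intermediate m'" "m' \<subset> L" "e' < e" for m' e'
    using that not_less_Least unfolding e_def by blast
  have mL: "m \<subseteq> L" using m(2) by blast
  \<comment> \<open>As \<open>m(L\<^sup>p) = L \<noteq> m\<close>, the exponent of \<open>L/m\<close> is unbounded, by the form of Nakayama's lemma above.\<close>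
  have unb: "\<not> L \<subseteq> root m L n" for n
  proof
    assume "L \<subseteq> root m L n"
    then have "pow L n \<subseteq> m" using pow_mono[of L "root m L n" n] pow_root_subset by blast
    moreover have "adjoin (adjoin m (pow L 1)) {} = L"
      using perfect[OF m(1,2)] adjoin_empty[OF intermediateD(1)[OF L]] by simp
    ultimately have "adjoin m {} = L" using generators_mod_pth_powers[OF m(1) L mL] by blast
    then show False using m(2) adjoin_empty[OF intermediateD(1)[OF m(1)]] by blast
  qed
  \<comment> \<open>The union of the divisible parts has unbounded exponent over \<open>m\<close>.\<close>
  let ?W = "\<Union>u. divisible_part m L u"
  have "?W = L"
  proof (rule ccontr)
    assume "?W \<noteq> L"
    then have "?W \<subset> L" using divisible_union_subset[OF m(1) L mL] by blast
    moreover obtain e' where "e' < e" "gen_bound ?W L e'"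
      using gen_bound_decreases[OF m(1) divisible_union_intermediate[OF m(1) L mL] L subset_divisible_union[OF m(1) L mL] divisible_union_subset[OF m(1) L mL] m(3)]
        divisible_union_unbounded[OF m(1) L mL unb] by blast
    ultimately show False using min divisible_union_intermediate[OF m(1) L mL] by blast
  qed
  have "\<exists>Y. finite Y \<and> Y \<subseteq> L \<and> (\<forall>B\<subseteq>carrier K. finite B \<and> card B < e \<longrightarrow> \<not> Y \<subseteq> adjoin m B)"
  proof (cases e)
    case (Suc e')
    show ?thesis
    proof (rule ccontr)
      assume none: "\<not> ?thesis"
      have "gen_bound m L e'"
      proof (rule gen_boundI_finite[OF m(1)])
        fix Y assume "finite Y" "Y \<subseteq> L"
        then obtain B where "B \<subseteq> carrier K" "finite B" "card B < e" "Y \<subseteq> adjoin m B" using none by blast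
        then show "\<exists>S\<subseteq>carrier K. finite S \<and> card S \<le> e' \<and> Y \<subseteq> adjoin m S"
          using Suc by (intro exI[of _ B]) simp
      qed
      then show False using min[OF m(1,2)] Suc by simp
    qed
  qed auto
  then obtain Y where Y: "finite Y" "Y \<subseteq> L"
    and no': "\<forall>B\<subseteq>carrier K. finite B \<and> card B < e \<longrightarrow> \<not> Y \<subseteq> adjoin m B" by (elim exE conjE)
  have no: "\<not> Y \<subseteq> adjoin m B" if "B \<subseteq> carrier K" "finite B" "card B < e" for B
    using no' that by simp
  obtain u where u: "Y \<subseteq> divisible_part m L u"
  proof -
    have mono: "divisible_part m L i \<subseteq> divisible_part m L j" if "i \<le> j" for i j
      using divisible_part_mono[OF m(1) L mL] that by (rule lift_Suc_mono_le)
    have "Y \<subseteq> ?W" using Y(2) \<open>?W = L\<close> by (simp only:)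
    with Y(1) have "\<exists>u. Y \<subseteq> divisible_part m L u"
    proof (induction Y)
      case (insert y Y)
      then obtain i j where "Y \<subseteq> divisible_part m L i" "y \<in> divisible_part m L j" by blast
      then show ?case using mono[of i "max i j"] mono[of j "max i j"] by (intro exI[of _ "max i j"]) auto
    qed simp
    then show ?thesis using that by blast
  qed
  obtain n where n: "\<And>i. deg (root m L n) (root m L (n + i)) = p ^ (e * i)"
    using eventually_equiexponential[OF m(1) L mL m(3) u no] by blast
  let ?m = "root m L n"
  have m': "intermediate ?m" by (rule intermediate_root[OF m(1) L])
  have m'L: "?m \<subseteq> L" by (rule root_subset)
  have "root ?m L i = root m L (n + i)" for i
  proof -
    have "(x [^] (p ^ i)) [^] (p ^ n) = x [^] (p ^ (n + i))" if "x \<in> L" for x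
      using that intermediateD(3)[OF L] by (auto simp: nat_pow_pow power_add mult.commute)
    then show ?thesis using subfield_pow_closed[OF intermediateD(1)[OF L]] by (auto simp: root_mem)
  qed
  then have "modular_extension K p ?m L"
    using modular_if_equiexponential[OF m' L m'L gen_bound_base[OF m(1) m' root_incl[OF m(1) mL] m(3)]] n by simp
  then show ?thesis using m' m'L unb[of n] by blast
qed

end

section \<open>The characterisation of \<open>q\<close>-finiteness\<close>

theorem mainTheorem11:
  fixes K :: "('a, 'b) ring_scheme" and k :: "'a set" and p :: nat
  assumes "field K"
    and "subfield k K"
    and "Factorial_Ring.prime p"
    and "[p] \<cdot>\<^bsub>K\<^esub> \<one>\<^bsub>K\<^esub> = \<zero>\<^bsub>K\<^esub>"
    and "purely_inseparable K p k (carrier K)"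
    and "absolutely_lq_finite K p k (carrier K)"
  shows "q_finite K p k (carrier K) \<longleftrightarrow>
    (\<forall>L. intermediate_field K k (carrier K) L \<and> L \<noteq> k \<longrightarrow>
       smallest_modular_subfield K p k L \<noteq> L)"
proof -
  interpret abs_lq_finite K p k
    using assms
    by (intro abs_lq_finite.intro purely_insep.intro char_p_field.intro char_p_field_axioms.intro
        purely_insep_axioms.intro abs_lq_finite_axioms.intro)
  have inter: "intermediate_field K k (carrier K) L \<longleftrightarrow> intermediate L" for L
    using subfieldE(3) unfolding intermediate_field_def intermediate_def by blast
  have lq: "lq_finite K p k (carrier K)"
    using abs_lq intermediate_ground by (simp add: absolutely_lq_finite_def inter)
  have "(\<exists>c. gen_bound k (carrier K) c) \<longleftrightarrow> (\<forall>L. intermediate L \<and> L \<noteq> k \<longrightarrow> smallest_modular_subfield K p k L \<noteq> L)"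
  proof
    assume "\<exists>c. gen_bound k (carrier K) c"
    then obtain c where c: "gen_bound k (carrier K) c" by blast
    show "\<forall>L. intermediate L \<and> L \<noteq> k \<longrightarrow> smallest_modular_subfield K p k L \<noteq> L"
    proof (intro allI impI, elim conjE)
      fix L assume L: "intermediate L" "L \<noteq> k"
      obtain m where "intermediate m" "m \<subset> L" "modular_extension K p m L"
        using proper_modular_subfield_exists[OF L gen_bound_subset[OF c intermediateD(3)[OF L(1)]]] by blast
      then show "smallest_modular_subfield K p k L \<noteq> L"
        using smallest_modular_subfield(4)[OF L(1), of m] by blast
    qed
  next
    assume "\<forall>L. intermediate L \<and> L \<noteq> k \<longrightarrow> smallest_modular_subfield K p k L \<noteq> L"
    then show "\<exists>c. gen_bound k (carrier K) c" by (intro gen_bound_if_smallest_modular_proper) blast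
  qed
  then show ?thesis by (simp add: q_finite_iff_gen_bound[OF lq] inter)
qed

end
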